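(* Let $C_2\times C_2=\langle g\rangle\times\langle h\rangle$ and let $[\alpha]\in H^2(\langle g,h\rangle,\mathbb{Z}^* )$ be determined by $u_g^2=u_h^2=1$, $[u_g,u_h]=-1$. For $i\ge1$ let $U_i=\{1+2^iu\mid u\in\mathbb{Z}^\alpha[\langle g,h\rangle]\}\cap\mathcal{U}(\mathbb{Z}^\alpha[\langle g,h\rangle])$. Then: - $[\mathcal{U}(\mathbb{Z}^\alpha[\langle g,h\rangle]):U_1]=8$; - $[U_i:U_{i+1}]=8$ for all $i\ge1$; - $U_1\cong F_3\times C_2$; - if $i\ge2$, then $U_i$ is a free group of rank $n_i=1+8^{i-1}$.
   Context: $\mathbb{Z}^\alpha[\langle g,h\rangle]$ is the twisted group ring: the free $\mathbb{Z}$-module with basis $u_1,u_g,u_h,u_{gh}$ and multiplication $u_xu_y=\alpha(x,y)u_{xy}$ with $\alpha$ a normalized $\{\pm1\}$-valued $2$-cocycle with the indicated relations (commutator $[a,b]=a^{-1}b^{-1}ab$). $\mathcal{U}(\cdot)$ is the unit group and $F_n$ the free group of rank $n$. *)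

theory Defs
  imports "HOL-Algebra.Algebra"
begin

section \<open>Twisted group rings\<close>

definition normalized_sign_cocycle :: "('a, 'm) monoid_scheme \<Rightarrow> ('a \<Rightarrow> 'a \<Rightarrow> int) \<Rightarrow> bool" where
  "normalized_sign_cocycle G \<alpha> \<longleftrightarrow>
     (\<forall>x\<in>carrier G. \<forall>y\<in>carrier G. \<alpha> x y \<in> {1, -1}) \<and>
     (\<forall>x\<in>carrier G. \<alpha> \<one>\<^bsub>G\<^esub> x = 1 \<and> \<alpha> x \<one>\<^bsub>G\<^esub> = 1) \<and>
     (\<forall>x\<in>carrier G. \<forall>y\<in>carrier G. \<forall>z\<in>carrier G.
        \<alpha> x y * \<alpha> (x \<otimes>\<^bsub>G\<^esub> y) z = \<alpha> y z * \<alpha> x (y \<otimes>\<^bsub>G\<^esub> z))"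

definition twisted_basis :: "'a \<Rightarrow> 'a \<Rightarrow> int" where
  "twisted_basis x = (\<lambda>z. if z = x then 1 else 0)"

text \<open>An element \<open>\<Sum>\<^sub>x a\<^sub>x u\<^sub>x\<close> is represented by its coefficient function \<open>x \<mapsto> a\<^sub>x\<close>, which vanishes
  outside a finite subset of \<open>carrier G\<close>; the product is the bilinear extension of
  \<open>u\<^sub>x u\<^sub>y = \<alpha>(x,y) u\<^sub>x\<^sub>y\<close>. The element \<open>u\<^sub>1\<close> is the identity because the cocycles used here are
  normalized.\<close>

definition twisted_group_ring ::
    "('a, 'm) monoid_scheme \<Rightarrow> ('a \<Rightarrow> 'a \<Rightarrow> int) \<Rightarrow> ('a \<Rightarrow> int) ring" where
  "twisted_group_ring G \<alpha> =
     \<lparr>carrier = {a. finite {x. a x \<noteq> 0} \<and> {x. a x \<noteq> 0} \<subseteq> carrier G},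
      monoid.mult = (\<lambda>a b z. \<Sum>x | a x \<noteq> 0. \<Sum>y | b y \<noteq> 0 \<and> x \<otimes>\<^bsub>G\<^esub> y = z. a x * b y * \<alpha> x y),
      one = twisted_basis \<one>\<^bsub>G\<^esub>,
      ring.zero = (\<lambda>z. 0),
      ring.add = (\<lambda>a b z. a z + b z)\<rparr>"

lemma twisted_basis_mult:
  "twisted_basis x \<otimes>\<^bsub>twisted_group_ring G \<alpha>\<^esub> twisted_basis y
     = (\<lambda>z. \<alpha> x y * twisted_basis (x \<otimes>\<^bsub>G\<^esub> y) z)"
proof
  fix z
  have 1: "{w. twisted_basis x w \<noteq> 0} = {x}" by (auto simp: twisted_basis_def)
  have 2: "{w. twisted_basis y w \<noteq> 0 \<and> x \<otimes>\<^bsub>G\<^esub> w = z} = (if x \<otimes>\<^bsub>G\<^esub> y = z then {y} else {})"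
    by (auto simp: twisted_basis_def)
  show "(twisted_basis x \<otimes>\<^bsub>twisted_group_ring G \<alpha>\<^esub> twisted_basis y) z
          = \<alpha> x y * twisted_basis (x \<otimes>\<^bsub>G\<^esub> y) z"
    by (simp add: twisted_group_ring_def 1 2) (auto simp: twisted_basis_def)
qed

definition congruence_units :: "('r, 'm) ring_scheme \<Rightarrow> nat \<Rightarrow> 'r set" where
  "congruence_units R i =
     {\<one>\<^bsub>R\<^esub> \<oplus>\<^bsub>R\<^esub> add_pow R (2 ^ i :: nat) u | u. u \<in> carrier R} \<inter> Units R"

section \<open>Free groups\<close>

text \<open>The letter \<open>(s, False)\<close> stands for the generator \<open>s\<close> and \<open>(s, True)\<close> for its formal inverse.
  Elements of the free group are the reduced words.\<close>

definition inv_letter :: "'s \<times> bool \<Rightarrow> 's \<times> bool" where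
  "inv_letter l = (fst l, \<not> snd l)"

definition reduced :: "('s \<times> bool) list \<Rightarrow> bool" where
  "reduced w \<longleftrightarrow> successively (\<lambda>k l. k \<noteq> inv_letter l) w"

fun push_letter :: "'s \<times> bool \<Rightarrow> ('s \<times> bool) list \<Rightarrow> ('s \<times> bool) list" where
  "push_letter k [] = [k]"
| "push_letter k (l # w) = (if k = inv_letter l then w else k # l # w)"

definition free_group :: "'s set \<Rightarrow> ('s \<times> bool) list monoid" where
  "free_group S =
     \<lparr>carrier = {w. reduced w \<and> fst ` set w \<subseteq> S},
      monoid.mult = (\<lambda>v w. foldr push_letter v w),
      one = []\<rparr>"

lemma inv_letter_inv_letter [simp]: "inv_letter (inv_letter l) = l"
  by (simp add: inv_letter_def)

lemma fst_inv_letter [simp]: "fst (inv_letter l) = fst l"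
  by (simp add: inv_letter_def)

lemma reduced_push_letter: "reduced w \<Longrightarrow> reduced (push_letter k w)"
  by (cases w) (auto simp: reduced_def successively_Cons)

lemma set_push_letter: "set (push_letter k w) \<subseteq> insert k (set w)"
  by (cases w) auto

lemma push_letter_inv: "reduced w \<Longrightarrow> push_letter k (push_letter (inv_letter k) w) = w"
  by (cases w rule: remdups_adj.cases)
    (auto simp: reduced_def, (metis inv_letter_inv_letter)+)

lemma reduced_foldr: "reduced w \<Longrightarrow> reduced (foldr push_letter v w)"
  by (induction v) (auto intro: reduced_push_letter)

lemma set_foldr: "set (foldr push_letter v w) \<subseteq> set v \<union> set w"
  by (induction v) (use set_push_letter in fastforce)+

lemma foldr_push_letter:
  assumes "reduced u" "reduced w"
  shows "foldr push_letter (push_letter k w) u = push_letter k (foldr push_letter w u)"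
proof (cases w)
  case (Cons l w')
  have "reduced (foldr push_letter w' u)" using assms(1) by (rule reduced_foldr)
  then have "push_letter (inv_letter l) (push_letter l (foldr push_letter w' u))
               = foldr push_letter w' u"
    using push_letter_inv[of _ "inv_letter l"] by simp
  with Cons show ?thesis by simp
qed simp

lemma foldr_push_assoc:
  assumes "reduced u" "reduced w"
  shows "foldr push_letter (foldr push_letter v w) u
           = foldr push_letter v (foldr push_letter w u)"
  using assms by (induction v) (auto simp: foldr_push_letter reduced_foldr)

lemma foldr_push_Nil: "reduced w \<Longrightarrow> foldr push_letter w [] = w"
proof (induction w)
  case (Cons k w)
  then have "foldr push_letter w [] = w"
    by (auto simp: reduced_def successively_Cons)
  with Cons.prems show ?case by (cases w) (auto simp: reduced_def)
qed simp

lemma foldr_push_inverse: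
  "reduced w \<Longrightarrow> foldr push_letter (map inv_letter (rev v)) (foldr push_letter v w) = w"
proof (induction v)
  case (Cons k v)
  have "push_letter (inv_letter k) (push_letter k (foldr push_letter v w)) = foldr push_letter v w"
    using push_letter_inv[of _ "inv_letter k"] reduced_foldr[OF Cons.prems] by simp
  with Cons show ?case by simp
qed simp

lemma group_free_group: "group (free_group S)"
proof (rule groupI)
  fix w assume "w \<in> carrier (free_group S)"
  then have w: "reduced w" "fst ` set w \<subseteq> S" by (auto simp: free_group_def)
  let ?v = "foldr push_letter (map inv_letter (rev w)) []"
  have "reduced ?v" by (rule reduced_foldr) (simp add: reduced_def)
  moreover have "fst ` set ?v \<subseteq> S"
  proof -
    have "fst ` set ?v \<subseteq> fst ` (inv_letter ` set w)"
      using set_foldr[of "map inv_letter (rev w)" "[]"] by (intro image_mono) simp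
    then show ?thesis using w(2) by (simp add: image_image)
  qed
  moreover have "foldr push_letter ?v w = []"
    using foldr_push_assoc[of w "[]" "map inv_letter (rev w)"] foldr_push_inverse[of "[]" w]
      foldr_push_Nil[OF w(1)] w(1) by (simp add: reduced_def)
  ultimately show "\<exists>v\<in>carrier (free_group S). v \<otimes>\<^bsub>free_group S\<^esub> w = \<one>\<^bsub>free_group S\<^esub>"
    by (intro bexI[of _ ?v]) (simp_all add: free_group_def)
next
  fix v w assume "v \<in> carrier (free_group S)" "w \<in> carrier (free_group S)"
  then show "v \<otimes>\<^bsub>free_group S\<^esub> w \<in> carrier (free_group S)"
    using set_foldr[of v w] by (fastforce simp: free_group_def intro: reduced_foldr)
qed (auto simp: free_group_def foldr_push_assoc, simp add: reduced_def)

end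

theory Submission
  imports Defs
begin

text \<open>Writing \<open>i = u\<^sub>g\<close>, \<open>j = u\<^sub>h\<close>, \<open>k = i j\<close>, the ring is the integral quaternion order with
  \<open>i\<^sup>2 = j\<^sup>2 = 1\<close> and \<open>k\<^sup>2 = -1\<close>, and its units are the elements of norm
  \<open>a\<^sup>2 - b\<^sup>2 - c\<^sup>2 + d\<^sup>2 = 1\<close> or \<open>-1\<close>. It embeds into the integral \<open>2 \<times> 2\<close> matrices by sending
  \<open>a + b i + c j + d k\<close> to the matrix with rows \<open>(a + b, c + d)\<close> and \<open>(c - d, a - b)\<close>, so that the
  norm becomes the determinant. Sanov's group (even off-diagonal entries, diagonal entries
  congruent to \<open>1\<close> modulo \<open>4\<close>) consists of units and is free of rank \<open>2\<close>, by ping-pong and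
  Euclidean descent. A subgroup of index \<open>2\<close> in a free group of rank \<open>n\<close> is free of rank
  \<open>2 n - 1\<close>. One such step leads from Sanov's group to a complement of \<open>{1, -1}\<close> in \<open>U\<^sub>1\<close>, of rank
  \<open>3\<close>; two more lead to \<open>U\<^sub>2\<close>, of rank \<open>9\<close>. For \<open>i \<ge> 2\<close> the residue of \<open>u\<close> modulo \<open>2\<close> is a
  homomorphism on the elements \<open>1 + 2\<^sup>i u\<close> of \<open>U\<^sub>i\<close>, with kernel \<open>U\<^sub>i\<^sub>+\<^sub>1\<close> and image of order \<open>8\<close>, so
  three steps lead from \<open>U\<^sub>i\<close> to \<open>U\<^sub>i\<^sub>+\<^sub>1\<close> and replace the rank \<open>n\<close> by \<open>8 n - 7\<close>.\<close>

section \<open>Subgroups of index two in free groups\<close>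

text \<open>The homomorphism that extends \<open>f\<close> from the generators to the free group. It
  accepts unreduced words too, so that values before and after a cancellation can be
  compared.\<close>

definition word_eval :: "('h, 'm) monoid_scheme \<Rightarrow> ('s \<Rightarrow> 'h) \<Rightarrow> ('s \<times> bool) list \<Rightarrow> 'h" where
  "word_eval H f w =
     foldr (\<lambda>l a. (if snd l then inv\<^bsub>H\<^esub> f (fst l) else f (fst l)) \<otimes>\<^bsub>H\<^esub> a) w \<one>\<^bsub>H\<^esub>"

lemma word_eval_Nil [simp]: "word_eval H f [] = \<one>\<^bsub>H\<^esub>"
  by (simp add: word_eval_def)

lemma word_eval_Cons:
  "word_eval H f (l # w) =
     (if snd l then inv\<^bsub>H\<^esub> f (fst l) else f (fst l)) \<otimes>\<^bsub>H\<^esub> word_eval H f w"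
  by (simp add: word_eval_def)

lemma (in group) word_eval_in_subgroup:
  assumes "subgroup K G" "f ` S \<subseteq> K" "fst ` set w \<subseteq> S"
  shows "word_eval G f w \<in> K"
  using assms(3)
proof (induction w)
  case Nil
  then show ?case by (simp add: subgroup.one_closed[OF assms(1)])
next
  case (Cons l w)
  then have "f (fst l) \<in> K" "word_eval G f w \<in> K" using assms(2) by auto
  then show ?case
    by (simp add: word_eval_Cons subgroup.m_closed[OF assms(1)] subgroup.m_inv_closed[OF assms(1)])
qed

lemma (in group) word_eval_closed:
  assumes "f ` S \<subseteq> carrier G" "fst ` set w \<subseteq> S"
  shows "word_eval G f w \<in> carrier G"
  using word_eval_in_subgroup[OF subgroup_self assms] .

text \<open>\<open>push_letter\<close> differs from consing only when it cancels a letter against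
  its inverse, and there the two factors also cancel in the group.\<close>

lemma (in group) word_eval_push_letter:
  assumes "f ` S \<subseteq> carrier G" "fst k \<in> S" "fst ` set w \<subseteq> S"
  shows "word_eval G f (push_letter k w) = word_eval G f (k # w)"
proof (cases "\<exists>l w'. w = l # w' \<and> k = inv_letter l")
  case True
  then obtain l w' where w: "w = l # w'" "k = inv_letter l" by blast
  have "f (fst l) \<in> carrier G" "word_eval G f w' \<in> carrier G"
    using w assms word_eval_closed[OF assms(1), of w'] by auto
  then show ?thesis
    by (auto simp: w word_eval_Cons inv_letter_def m_assoc[symmetric])
next
  case False
  then show ?thesis by (cases w) auto
qed

lemma (in group) word_eval_foldr_push_letter:
  assumes "f ` S \<subseteq> carrier G" "fst ` set v \<subseteq> S" "fst ` set w \<subseteq> S"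
  shows "word_eval G f (foldr push_letter v w) = word_eval G f v \<otimes> word_eval G f w"
  using assms(2)
proof (induction v)
  case Nil
  then show ?case using word_eval_closed[OF assms(1,3)] by simp
next
  case (Cons k v)
  have cl: "f (fst k) \<in> carrier G" "word_eval G f v \<in> carrier G" "word_eval G f w \<in> carrier G"
    using Cons.prems assms(1,3) word_eval_closed[OF assms(1)] by auto
  have "fst ` set (foldr push_letter v w) \<subseteq> S"
    using set_foldr[of v w] Cons.prems assms(3) by fastforce
  then show ?case
    using Cons word_eval_push_letter[OF assms(1), of k "foldr push_letter v w"] cl
    by (simp add: word_eval_Cons m_assoc)
qed

lemma (in group) word_eval_hom:
  assumes "f ` S \<subseteq> carrier G"
  shows "word_eval G f \<in> hom (free_group S) G"
  using word_eval_closed[OF assms] word_eval_foldr_push_letter[OF assms]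
  by (auto simp: hom_def free_group_def)

lemma (in group) word_eval_generator:
  "f s \<in> carrier G \<Longrightarrow> word_eval G f [(s, False)] = f s"
  by (simp add: word_eval_Cons)

lemma generator_in_free_group: "s \<in> S \<Longrightarrow> [(s, b)] \<in> carrier (free_group S)"
  by (simp add: free_group_def reduced_def)

lemma inv_generator:
  assumes "s \<in> S"
  shows "inv\<^bsub>free_group S\<^esub> [(s, False)] = [(s, True)]"
proof -
  interpret group "free_group S" by (rule group_free_group)
  show ?thesis
    by (rule inv_equality) (use assms in \<open>auto simp: generator_in_free_group, auto simp: free_group_def inv_letter_def\<close>)
qed

text \<open>A nonempty reduced word is its first letter times its tail, since pushing that letter
  back cancels nothing. The rule replaces list structure by group products.\<close>

lemma free_group_induct [consumes 1, case_names one mult]: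
  assumes w: "w \<in> carrier (free_group S)"
    and one: "P \<one>\<^bsub>free_group S\<^esub>"
    and mult: "\<And>s b w. s \<in> S \<Longrightarrow> w \<in> carrier (free_group S) \<Longrightarrow> P w \<Longrightarrow>
      P ([(s, b)] \<otimes>\<^bsub>free_group S\<^esub> w)"
  shows "P w"
  using w
proof (induction w)
  case Nil
  then show ?case using one by (simp add: free_group_def)
next
  case (Cons k w)
  have w: "w \<in> carrier (free_group S)" "fst k \<in> S"
    using Cons.prems by (auto simp: free_group_def reduced_def successively_Cons)
  have "push_letter k w = k # w"
    using Cons.prems by (cases w) (auto simp: free_group_def reduced_def)
  then show ?case
    using mult[OF w(2,1) Cons.IH[OF w(1)], of "snd k"] by (simp add: free_group_def)
qed

text \<open>Uniqueness in the universal property: values on inverse letters are forced by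
  \<open>hom_inv\<close>. Composite maps can then be compared on generators alone.\<close>

lemma free_group_hom_eqI:
  assumes "group H" "\<phi> \<in> hom (free_group S) H" "\<psi> \<in> hom (free_group S) H"
    and "\<And>s. s \<in> S \<Longrightarrow> \<phi> [(s, False)] = \<psi> [(s, False)]"
    and "w \<in> carrier (free_group S)"
  shows "\<phi> w = \<psi> w"
proof -
  interpret \<phi>: group_hom "free_group S" H \<phi>
    using assms(1,2) by (simp add: group_hom_def group_hom_axioms_def group_free_group)
  interpret \<psi>: group_hom "free_group S" H \<psi>
    using assms(1,3) by (simp add: group_hom_def group_hom_axioms_def group_free_group)
  show ?thesis
    using assms(5)
  proof (induction w rule: free_group_induct)
    case (mult s b w)
    have "\<phi> [(s, b)] = \<psi> [(s, b)]"
      using assms(4)[OF mult(1)] generator_in_free_group[OF mult(1)]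
        \<phi>.hom_inv[of "[(s, False)]"] \<psi>.hom_inv[of "[(s, False)]"] inv_generator[OF mult(1)]
      by (cases b) auto
    then show ?case using mult generator_in_free_group[OF mult(1), of b] by simp
  qed (simp only: \<phi>.hom_one \<psi>.hom_one)
qed

text \<open>Both composites fix the generators, so they are the identity by uniqueness. This later
  renames the Schreier index pairs to an initial segment of the naturals.\<close>

lemma free_group_iso_bij:
  assumes "bij_betw f S T"
  shows "free_group S \<cong> free_group T"
proof -
  interpret S: group "free_group S" by (rule group_free_group)
  interpret T: group "free_group T" by (rule group_free_group)
  define f' where "f' = inv_into S f"
  define \<phi> where "\<phi> = word_eval (free_group T) (\<lambda>s. [(f s, False)])"
  define \<psi> where "\<psi> = word_eval (free_group S) (\<lambda>t. [(f' t, False)])"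
  have f: "f s \<in> T" "f' (f s) = s" if "s \<in> S" for s
    using that assms by (auto simp: f'_def bij_betw_def)
  have f': "f' t \<in> S" "f (f' t) = t" if "t \<in> T" for t
    using that assms by (auto simp: f'_def bij_betw_def inv_into_into f_inv_into_f)
  have gens: "(\<lambda>s. [(f s, False)]) ` S \<subseteq> carrier (free_group T)"
    "(\<lambda>t. [(f' t, False)]) ` T \<subseteq> carrier (free_group S)"
    using f f' by (auto simp: generator_in_free_group)
  have \<phi>: "\<phi> \<in> hom (free_group S) (free_group T)"
    unfolding \<phi>_def by (rule T.word_eval_hom[OF gens(1)])
  have \<psi>: "\<psi> \<in> hom (free_group T) (free_group S)"
    unfolding \<psi>_def by (rule S.word_eval_hom[OF gens(2)])
  have "\<psi> (\<phi> w) = w" if "w \<in> carrier (free_group S)" for w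
    using free_group_hom_eqI[OF group_free_group hom_compose[OF \<phi> \<psi>] _ _ that, of id] f
    by (simp add: hom_def \<phi>_def \<psi>_def T.word_eval_generator S.word_eval_generator generator_in_free_group)
  moreover have "\<phi> (\<psi> w) = w" if "w \<in> carrier (free_group T)" for w
    using free_group_hom_eqI[OF group_free_group hom_compose[OF \<psi> \<phi>] _ _ that, of id] f'
    by (simp add: hom_def \<phi>_def \<psi>_def T.word_eval_generator S.word_eval_generator generator_in_free_group)
  ultimately have "bij_betw \<phi> (carrier (free_group S)) (carrier (free_group T))"
    using \<phi> \<psi> by (intro bij_betwI[where g = \<psi>]) (auto simp: hom_def)
  with \<phi> show ?thesis by (auto simp: is_iso_def iso_def)
qed

section \<open>Parity kernels and Schreier rewriting\<close>

text \<open>The predicate \<open>par\<close> is a homomorphism to the group of order two, with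
  inequality of truth values as addition. Working relative to \<open>K\<close> lets kernels be
  nested inside one ambient group.\<close>

lemma (in group) parity_kernel_subgroup:
  assumes "subgroup K G"
    and par: "\<And>v w. v \<in> K \<Longrightarrow> w \<in> K \<Longrightarrow> par (v \<otimes> w) = (par v \<noteq> par w)"
  shows "subgroup {w \<in> K. \<not> par w} G"
proof -
  interpret K: subgroup K G by fact
  have one: "\<not> par \<one>" using par[of \<one> \<one>] by simp
  have "\<not> par (inv w)" if "w \<in> K" "\<not> par w" for w
    using par[of "inv w" w] that one by simp
  then show ?thesis
    by (intro subgroupI) (use one par in \<open>auto intro!: exI[of _ \<one>]\<close>)
qed

text \<open>The triple stands for a monomial 2 by 2 matrix over \<open>L\<close>: \<open>a\<close>
  and \<open>b\<close> are the entries of the first and second row, on the diagonal if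
  \<open>e\<close> is false and off it if \<open>e\<close> is true.\<close>

definition wreath2 :: "('a, 'm) monoid_scheme \<Rightarrow> ('a \<times> 'a \<times> bool) monoid" where
  "wreath2 L =
     \<lparr>carrier = carrier L \<times> carrier L \<times> UNIV,
      monoid.mult = (\<lambda>(a, b, e) (c, d, e').
        if e then (a \<otimes>\<^bsub>L\<^esub> d, b \<otimes>\<^bsub>L\<^esub> c, \<not> e') else (a \<otimes>\<^bsub>L\<^esub> c, b \<otimes>\<^bsub>L\<^esub> d, e')),
      one = (\<one>\<^bsub>L\<^esub>, \<one>\<^bsub>L\<^esub>, False)\<rparr>"

lemma wreath2_simps [simp]:
  "carrier (wreath2 L) = carrier L \<times> carrier L \<times> UNIV"
  "(a, b, e) \<otimes>\<^bsub>wreath2 L\<^esub> (c, d, e') =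
     (if e then (a \<otimes>\<^bsub>L\<^esub> d, b \<otimes>\<^bsub>L\<^esub> c, \<not> e') else (a \<otimes>\<^bsub>L\<^esub> c, b \<otimes>\<^bsub>L\<^esub> d, e'))"
  "\<one>\<^bsub>wreath2 L\<^esub> = (\<one>\<^bsub>L\<^esub>, \<one>\<^bsub>L\<^esub>, False)"
  by (auto simp: wreath2_def)

lemma (in group) group_wreath2: "group (wreath2 G)"
proof (rule groupI)
  fix x assume "x \<in> carrier (wreath2 G)"
  then obtain a b e where x: "x = (a, b, e)" "a \<in> carrier G" "b \<in> carrier G"
    by (auto simp del: split_paired_Ex)
  show "\<exists>y\<in>carrier (wreath2 G). y \<otimes>\<^bsub>wreath2 G\<^esub> x = \<one>\<^bsub>wreath2 G\<^esub>"
    by (rule bexI[of _ "if e then (inv b, inv a, True) else (inv a, inv b, False)"])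
      (use x in auto)
qed (auto simp: m_assoc split: if_splits)

text \<open>Reidemeister-Schreier with transversal \<open>{1, x}\<close>. The generators \<open>\<gamma> (s, t) = x\<^sup>t s x\<^sup>-\<^sup>t\<^sup>'\<close> define
  \<open>\<psi> : L \<rightarrow> F\<close>; its inverse on the kernel is the first component of the homomorphism \<open>\<Theta>\<close> from \<open>F\<close>
  to the wreath product of \<open>L\<close> with \<open>C\<^sub>2\<close>. That they are inverse to each other follows by
  comparing homomorphisms on free generators: \<open>\<omega> \<circ> \<Theta>\<close> with the induced embedding \<open>\<eta>\<close>.\<close>

lemma index2_subgroup_free_group:
  fixes S :: "'s set" and par :: "('s \<times> bool) list \<Rightarrow> bool"
  assumes par: "\<And>v w. v \<in> carrier (free_group S) \<Longrightarrow> w \<in> carrier (free_group S) \<Longrightarrow>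
      par (v \<otimes>\<^bsub>free_group S\<^esub> w) = (par v \<noteq> par w)"
    and x: "x \<in> S" "par [(x, False)]"
  shows "(free_group S)\<lparr>carrier := {w \<in> carrier (free_group S). \<not> par w}\<rparr>
    \<cong> free_group (S \<times> UNIV - {(x, False)})"
proof -
  define F where "F = free_group S"
  define T where "T = S \<times> UNIV - {(x, False)}"
  define L where "L = free_group T"
  define K where "K = {w \<in> carrier F. \<not> par w}"
  interpret F: group F unfolding F_def by (rule group_free_group)
  interpret L: group L unfolding L_def by (rule group_free_group)
  interpret WL: group "wreath2 L" by (rule L.group_wreath2)
  interpret WF: group "wreath2 F" by (rule F.group_wreath2)
  have par_mult: "par (v \<otimes>\<^bsub>F\<^esub> w) = (par v \<noteq> par w)" if "v \<in> carrier F" "w \<in> carrier F" for v w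
    using par that by (simp add: F_def)
  have par_one: "\<not> par \<one>\<^bsub>F\<^esub>"
    using par_mult[of "\<one>\<^bsub>F\<^esub>" "\<one>\<^bsub>F\<^esub>"] by simp
  have par_inv: "par (inv\<^bsub>F\<^esub> w) = par w" if "w \<in> carrier F" for w
    using par_mult[of "inv\<^bsub>F\<^esub> w" w] par_one that by simp
  have K: "subgroup K F"
    unfolding K_def by (rule F.parity_kernel_subgroup[OF F.subgroup_self par_mult])
  define gen :: "'s \<Rightarrow> ('s \<times> bool) list" where "gen s = [(s, False)]" for s
  have gen [simp]: "gen s \<in> carrier F" if "s \<in> S" for s
    using that by (simp add: gen_def F_def generator_in_free_group)
  have par_x: "par (gen x)" using x by (simp add: gen_def)
  define xpow where "xpow e = (if e then gen x else \<one>\<^bsub>F\<^esub>)" for e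
  have xpow [simp]: "xpow e \<in> carrier F" "par (xpow e) = e" for e
    using gen[OF x(1)] par_x par_one by (auto simp: xpow_def)
  \<comment> \<open>The last factor inverts the representative of the coset reached, so
    \<open>\<gamma> (s, t)\<close> has even parity. At \<open>(x, False)\<close> the value is
    trivial, which is why \<open>T\<close> omits that pair.\<close>
  define \<gamma> where "\<gamma> = (\<lambda>(s, t). xpow t \<otimes>\<^bsub>F\<^esub> gen s \<otimes>\<^bsub>F\<^esub> inv\<^bsub>F\<^esub> (xpow (t \<noteq> par (gen s))))"
  have \<gamma>K: "\<gamma> ` (S \<times> UNIV) \<subseteq> K"
    by (auto simp: \<gamma>_def K_def par_mult par_inv)
  then have \<gamma>T: "\<gamma> ` T \<subseteq> K" "\<gamma> ` T \<subseteq> carrier F"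
    by (auto simp: T_def K_def)
  define \<psi> where "\<psi> = word_eval F \<gamma>"
  have \<psi>: "\<psi> \<in> hom L F"
    unfolding \<psi>_def L_def by (rule F.word_eval_hom[OF \<gamma>T(2)])
  interpret \<psi>: group_hom L F \<psi>
    using \<psi> by (simp add: group_hom_def group_hom_axioms_def L.group_axioms F.group_axioms)
  have \<psi>K: "\<psi> v \<in> K" if "v \<in> carrier L" for v
    using that F.word_eval_in_subgroup[OF K \<gamma>T(1), of v]
    by (auto simp: \<psi>_def L_def free_group_def)
  \<comment> \<open>Reading the omitted pair as the identity makes
    \<open>\<psi> (c s t) = \<gamma> (s, t)\<close> hold at \<open>(x, False)\<close> as
    well.\<close>
  define c where "c s t = (if (s, t) = (x, False) then \<one>\<^bsub>L\<^esub> else [((s, t), False)])" for s t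
  have c [simp]: "c s t \<in> carrier L" if "s \<in> S" for s t
    using that generator_in_free_group[of "(s, t)" T False] L.one_closed
    by (auto simp: c_def L_def T_def)
  have \<psi>c: "\<psi> (c s t) = \<gamma> (s, t)" if "s \<in> S" for s t
  proof (cases "(s, t) = (x, False)")
    case True
    then show ?thesis using x(1) par_x by (simp add: c_def \<gamma>_def xpow_def)
  next
    case False
    then have "(s, t) \<in> T" using that by (simp add: T_def)
    then have "\<gamma> (s, t) \<in> carrier F" using \<gamma>T(2) by blast
    then show ?thesis using False F.word_eval_generator[of \<gamma>] by (auto simp: c_def \<psi>_def)
  qed
  \<comment> \<open>The monomial matrix by which \<open>s\<close> acts on the two cosets; its row
    for coset \<open>t\<close> carries \<open>c s t\<close>.\<close>
  define \<theta> where "\<theta> s = (c s False, c s True, par (gen s))" for s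
  define \<Theta> where "\<Theta> = word_eval (wreath2 L) \<theta>"
  have \<theta>: "\<theta> ` S \<subseteq> carrier (wreath2 L)" by (auto simp: \<theta>_def)
  have \<Theta>: "\<Theta> \<in> hom F (wreath2 L)"
    unfolding \<Theta>_def F_def by (rule WL.word_eval_hom[OF \<theta>])
  interpret \<Theta>: group_hom F "wreath2 L" \<Theta>
    using \<Theta> by (simp add: group_hom_def group_hom_axioms_def WL.group_axioms F.group_axioms)
  have \<Theta>_gen: "\<Theta> (gen s) = \<theta> s" if "s \<in> S" for s
    using that \<theta> WL.word_eval_generator[of \<theta> s] by (auto simp: \<Theta>_def gen_def)
  define \<omega> where "\<omega> = (\<lambda>(a, b, e::bool). (\<psi> a, \<psi> b, e))"
  have \<omega>: "\<omega> \<in> hom (wreath2 L) (wreath2 F)"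
    by (rule homI) (auto simp: \<omega>_def)
  \<comment> \<open>The induced embedding: each row holds a representative times \<open>w\<close>
    times the inverse of the representative reached. Neighbouring representatives cancel in
    products, by \<open>cancel\<close>.\<close>
  define \<eta> where "\<eta> w = (w \<otimes>\<^bsub>F\<^esub> inv\<^bsub>F\<^esub> xpow (par w), xpow True \<otimes>\<^bsub>F\<^esub> w \<otimes>\<^bsub>F\<^esub> inv\<^bsub>F\<^esub> xpow (\<not> par w), par w)" for w
  have cancel: "a \<otimes>\<^bsub>F\<^esub> inv\<^bsub>F\<^esub> z \<otimes>\<^bsub>F\<^esub> (z \<otimes>\<^bsub>F\<^esub> b) = a \<otimes>\<^bsub>F\<^esub> b"
    if "a \<in> carrier F" "b \<in> carrier F" "z \<in> carrier F" for a b z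
    using that by (metis F.inv_closed F.inv_solve_left F.m_assoc F.m_closed)
  have xpow_False: "xpow False = \<one>\<^bsub>F\<^esub>" by (simp add: xpow_def)
  have \<eta>: "\<eta> \<in> hom F (wreath2 F)"
  proof (rule homI)
    fix v w assume "v \<in> carrier F" "w \<in> carrier F"
    then show "\<eta> (v \<otimes>\<^bsub>F\<^esub> w) = \<eta> v \<otimes>\<^bsub>wreath2 F\<^esub> \<eta> w"
      using cancel[of v "w \<otimes>\<^bsub>F\<^esub> inv\<^bsub>F\<^esub> xpow (\<not> par w)" "xpow True"]
        cancel[of "xpow True \<otimes>\<^bsub>F\<^esub> v" "w \<otimes>\<^bsub>F\<^esub> inv\<^bsub>F\<^esub> xpow (\<not> par w)" "xpow True"]
      by (auto simp: \<eta>_def par_mult xpow_False F.m_assoc)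
  qed (auto simp: \<eta>_def)
  have \<omega>\<Theta>: "\<omega> (\<Theta> w) = \<eta> w" if "w \<in> carrier F" for w
  proof -
    have "(\<omega> \<circ> \<Theta>) w = \<eta> w"
    proof (rule free_group_hom_eqI[OF WF.group_axioms])
      show "\<omega> \<circ> \<Theta> \<in> hom (free_group S) (wreath2 F)"
        using hom_compose[OF \<Theta> \<omega>] by (simp add: F_def)
      show "\<eta> \<in> hom (free_group S) (wreath2 F)" using \<eta> by (simp add: F_def)
      show "(\<omega> \<circ> \<Theta>) [(s, False)] = \<eta> [(s, False)]" if "s \<in> S" for s
        using that unfolding gen_def[symmetric]
        by (auto simp: \<Theta>_gen \<theta>_def \<omega>_def \<psi>c \<eta>_def \<gamma>_def xpow_False)
    qed (use that in \<open>simp add: F_def\<close>)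
    then show ?thesis by simp
  qed
  have snd_\<Theta>: "snd (snd (\<Theta> w)) = par w" if "w \<in> carrier F" for w
    using \<omega>\<Theta>[OF that] by (cases "\<Theta> w") (auto simp: \<omega>_def \<eta>_def)
  have \<psi>\<Theta>: "\<psi> (fst (\<Theta> w)) = w" if "w \<in> K" for w
    using \<omega>\<Theta>[of w] that by (cases "\<Theta> w") (auto simp: \<omega>_def \<eta>_def K_def xpow_False)
  have fst_\<Theta>: "fst (\<Theta> w) \<in> carrier L" if "w \<in> carrier F" for w
    using \<Theta>.hom_closed[OF that] by auto
  have fst_mult: "fst (\<Theta> (v \<otimes>\<^bsub>F\<^esub> w)) = fst (\<Theta> v) \<otimes>\<^bsub>L\<^esub> fst (\<Theta> w)"
    if "v \<in> K" "w \<in> K" for v w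
    using that snd_\<Theta>[of v] by (cases "\<Theta> v"; cases "\<Theta> w") (auto simp: K_def)
  have c_x: "c x False = \<one>\<^bsub>L\<^esub>" by (simp add: c_def)
  have inv_\<Theta>: "inv\<^bsub>wreath2 L\<^esub> (\<one>\<^bsub>L\<^esub>, c x True, True) = (inv\<^bsub>L\<^esub> c x True, \<one>\<^bsub>L\<^esub>, True)"
    by (rule WL.inv_equality) (use x in auto)
  \<comment> \<open>Left multiplication by \<open>\<Theta> (gen x)\<close> brings the second row to
    the first, so the first entry reads off the row for coset \<open>t\<close>.\<close>
  have \<Theta>_\<gamma>: "fst (\<Theta> (\<gamma> (s, t))) = c s t" if "s \<in> S" for s t
  proof -
    have "\<Theta> (xpow e) = (if e then (\<one>\<^bsub>L\<^esub>, c x True, True) else \<one>\<^bsub>wreath2 L\<^esub>)" for e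
      using x \<Theta>_gen[OF x(1)] by (simp add: xpow_def \<theta>_def c_x par_x)
    then show ?thesis
      using that inv_\<Theta> WL.inv_one \<Theta>_gen[OF that] x
      by (cases t; cases "par (gen s)") (simp_all add: \<gamma>_def \<theta>_def)
  qed
  have \<Theta>\<psi>: "fst (\<Theta> (\<psi> v)) = v" if "v \<in> carrier L" for v
  proof -
    have "(fst \<circ> \<Theta> \<circ> \<psi>) v = id v"
    proof (rule free_group_hom_eqI[where \<phi> = "fst \<circ> \<Theta> \<circ> \<psi>" and \<psi> = id and S = T, OF L.group_axioms])
      \<comment> \<open>The first entry is multiplicative on diagonal matrices, and
        \<open>\<psi>\<close> maps into \<open>K\<close>, where \<open>\<Theta>\<close> is
        diagonal.\<close>
      show "fst \<circ> \<Theta> \<circ> \<psi> \<in> hom (free_group T) L"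
        unfolding L_def[symmetric] by (rule homI) (use \<psi>K K_def fst_\<Theta> fst_mult in auto)
      show "(fst \<circ> \<Theta> \<circ> \<psi>) [(u, False)] = id [(u, False)]" if "u \<in> T" for u
        using that \<psi>c[of "fst u" "snd u"] \<Theta>_\<gamma>[of "fst u" "snd u"]
        by (auto simp: c_def T_def split: if_splits)
    qed (use that in \<open>auto simp: L_def hom_def\<close>)
    then show ?thesis by simp
  qed
  have "bij_betw \<psi> (carrier L) K"
    by (rule bij_betwI[where g = "fst \<circ> \<Theta>"]) (use \<psi>K \<Theta>\<psi> \<psi>\<Theta> fst_\<Theta> in \<open>auto simp: K_def\<close>)
  then have "L \<cong> F\<lparr>carrier := K\<rparr>"
    by (auto simp: is_iso_def iso_def hom_def bij_betw_def intro!: exI[of _ \<psi>])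
  then have "F\<lparr>carrier := K\<rparr> \<cong> L"
    using L.iso_sym by blast
  then show ?thesis by (simp add: F_def L_def K_def T_def)
qed

section \<open>Transfer to groups isomorphic to a free group\<close>

lemma iso_restrict_carrier:
  assumes "\<phi> \<in> iso G H" "K \<subseteq> carrier G" "\<phi> ` K = K'"
  shows "\<phi> \<in> iso (G\<lparr>carrier := K\<rparr>) (H\<lparr>carrier := K'\<rparr>)"
  using assms by (auto simp: iso_def hom_def bij_betw_def Pi_iff subset_eq intro: inj_on_subset)

text \<open>A parity that is nontrivial on the group is nontrivial on some free generator, which
  serves as the Schreier representative. The 2 n index pairs minus the omitted one give the
  rank.\<close>

lemma index2_subgroup_free:
  assumes "group H" and free: "H \<cong> free_group {..<n::nat}"
    and par: "\<And>v w. v \<in> carrier H \<Longrightarrow> w \<in> carrier H \<Longrightarrow> par (v \<otimes>\<^bsub>H\<^esub> w) = (par v \<noteq> par w)"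
    and x: "x \<in> carrier H" "par x"
  shows "H\<lparr>carrier := {w \<in> carrier H. \<not> par w}\<rparr> \<cong> free_group {..<2 * n - 1}"
proof -
  interpret H: group H by fact
  interpret F: group "free_group {..<n}" by (rule group_free_group)
  obtain \<phi> where \<phi>: "\<phi> \<in> iso (free_group {..<n}) H"
    using H.iso_sym[OF free] by (auto simp: is_iso_def)
  then have \<phi>_hom: "\<phi> \<in> hom (free_group {..<n}) H"
    and bij: "bij_betw \<phi> (carrier (free_group {..<n})) (carrier H)"
    by (auto simp: iso_def)
  define par' where "par' = par \<circ> \<phi>"
  have par': "par' (v \<otimes>\<^bsub>free_group {..<n}\<^esub> w) = (par' v \<noteq> par' w)"
    if "v \<in> carrier (free_group {..<n})" "w \<in> carrier (free_group {..<n})" for v w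
    using that \<phi>_hom by (auto simp: par'_def hom_def par Pi_iff)
  have par'_one: "\<not> par' \<one>\<^bsub>free_group {..<n}\<^esub>"
    using par'[of "\<one>\<^bsub>free_group {..<n}\<^esub>" "\<one>\<^bsub>free_group {..<n}\<^esub>"] by simp
  obtain w where w: "w \<in> carrier (free_group {..<n})" "par' w"
    using bij x unfolding bij_betw_def par'_def by (metis comp_apply imageE)
  \<comment> \<open>If all generators were even, so would be all letters and hence all words,
    contrary to \<open>w\<close>.\<close>
  obtain s where s: "s \<in> {..<n}" "par' [(s, False)]"
  proof (rule ccontr)
    assume "\<not> thesis"
    then have gens: "\<not> par' [(s, False)]" if "s \<in> {..<n}" for s
      using that \<open>\<And>s. \<lbrakk>s \<in> {..<n}; par' [(s, False)]\<rbrakk> \<Longrightarrow> thesis\<close> by blast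
    have "\<not> par' [(s, b)]" if "s \<in> {..<n}" for s b
      using gens[OF that] par'[of "[(s, False)]" "[(s, True)]"] par'_one
        F.r_inv[of "[(s, False)]"] inv_generator[OF that] generator_in_free_group[OF that]
      by (cases b) auto
    note letters = this
    have "\<not> par' v" if "v \<in> carrier (free_group {..<n})" for v
      using that by (induction v rule: free_group_induct)
        (simp_all add: letters par'_one par' generator_in_free_group)
    with w(1) have "\<not> par' w" by blast
    with w(2) show False by simp
  qed
  have "card ({..<n} \<times> (UNIV :: bool set) - {(s, False)}) = card {..<2 * n - 1}"
    using s(1) by (simp add: card_Diff_singleton card_cartesian_product card_UNIV_bool)
  then obtain f where "bij_betw f ({..<n} \<times> (UNIV :: bool set) - {(s, False)}) {..<2 * n - 1}"
    using finite_same_card_bij[of "{..<n} \<times> (UNIV :: bool set) - {(s, False)}" "{..<2 * n - 1}"] by auto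
  then have "(free_group {..<n})\<lparr>carrier := {w \<in> carrier (free_group {..<n}). \<not> par' w}\<rparr>
      \<cong> free_group {..<2 * n - 1}"
    using iso_trans[OF index2_subgroup_free_group[OF par' s] free_group_iso_bij] by blast
  moreover have "\<phi> ` {w \<in> carrier (free_group {..<n}). \<not> par' w} = {w \<in> carrier H. \<not> par w}"
    using bij by (auto simp: bij_betw_def par'_def)
  then have "(free_group {..<n})\<lparr>carrier := {w \<in> carrier (free_group {..<n}). \<not> par' w}\<rparr>
      \<cong> H\<lparr>carrier := {w \<in> carrier H. \<not> par w}\<rparr>"
    using iso_restrict_carrier[OF \<phi>, of "{w \<in> carrier (free_group {..<n}). \<not> par' w}"]
    by (auto simp: is_iso_def)
  moreover have "group ((free_group {..<n})\<lparr>carrier := {w \<in> carrier (free_group {..<n}). \<not> par' w}\<rparr>)"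
    by (rule F.subgroup_imp_group[OF F.parity_kernel_subgroup[OF F.subgroup_self par']])
  ultimately show ?thesis
    by (meson group.iso_sym iso_trans)
qed

lemma (in group) parity_kernel_free:
  assumes K: "subgroup K G" and free: "G\<lparr>carrier := K\<rparr> \<cong> free_group {..<n::nat}"
    and par: "\<And>v w. v \<in> K \<Longrightarrow> w \<in> K \<Longrightarrow> par (v \<otimes> w) = (par v \<noteq> par w)"
    and "x \<in> K" "par x"
  shows "G\<lparr>carrier := {w \<in> K. \<not> par w}\<rparr> \<cong> free_group {..<2 * n - 1}"
  using index2_subgroup_free[OF subgroup_imp_group[OF K] free, of par x] assms(3-5) by simp

section \<open>The quaternion order\<close>

text \<open>The tuple \<open>(a, b, c, d)\<close> stands for \<open>a + b i + c j + d k\<close> with \<open>i\<^sup>2 = j\<^sup>2 = 1\<close> and \<open>k = i j = - j i\<close>.\<close>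

type_synonym quad = "int \<times> int \<times> int \<times> int"

definition sq_norm :: "quad \<Rightarrow> int" where
  "sq_norm = (\<lambda>(a, b, c, d). a * a - b * b - c * c + d * d)"

text \<open>Only the carrier is cut down to the units. The product is that of the whole order, so
  \<open>sq_norm_mult\<close> and \<open>sq_assoc\<close> hold for all quadruples and later serve
  the ring itself.\<close>

definition sq_group :: "quad monoid" where
  "sq_group =
     \<lparr>carrier = {x. sq_norm x \<in> {1, -1}},
      monoid.mult = (\<lambda>(a, b, c, d) (a', b', c', d').
        (a * a' + b * b' + c * c' - d * d', a * b' + b * a' - c * d' + d * c',
         a * c' + c * a' + b * d' - d * b', a * d' + d * a' + b * c' - c * b')),
      one = (1, 0, 0, 0)\<rparr>"

lemma sq_group_simps [simp]:
  "x \<in> carrier sq_group \<longleftrightarrow> sq_norm x \<in> {1, -1}"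
  "(a, b, c, d) \<otimes>\<^bsub>sq_group\<^esub> (a', b', c', d') =
     (a * a' + b * b' + c * c' - d * d', a * b' + b * a' - c * d' + d * c',
      a * c' + c * a' + b * d' - d * b', a * d' + d * a' + b * c' - c * b')"
  "\<one>\<^bsub>sq_group\<^esub> = (1, 0, 0, 0)"
  by (simp_all add: sq_group_def)

lemma sq_norm_simp [simp]: "sq_norm (a, b, c, d) = a * a - b * b - c * c + d * d"
  by (simp add: sq_norm_def)

lemma sq_norm_mult: "sq_norm (x \<otimes>\<^bsub>sq_group\<^esub> y) = sq_norm x * sq_norm y"
  by (cases x; cases y) (simp add: algebra_simps)

lemma sq_norm_closed: "sq_norm x \<in> {1, -1} \<Longrightarrow> sq_norm y \<in> {1, -1} \<Longrightarrow> sq_norm (x \<otimes>\<^bsub>sq_group\<^esub> y) \<in> {1, -1}"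
  by (auto simp: sq_norm_mult)

lemma sq_assoc: "x \<otimes>\<^bsub>sq_group\<^esub> y \<otimes>\<^bsub>sq_group\<^esub> z = x \<otimes>\<^bsub>sq_group\<^esub> (y \<otimes>\<^bsub>sq_group\<^esub> z)"
  by (cases x; cases y; cases z) (simp add: algebra_simps)

text \<open>The quaternion conjugate times the norm. For norm 1 or -1 this is the inverse, since
  such a norm is its own reciprocal.\<close>

definition sq_conj :: "quad \<Rightarrow> quad" where
  "sq_conj = (\<lambda>(a, b, c, d). let n = sq_norm (a, b, c, d) in (n * a, - n * b, - n * c, - n * d))"

lemma sq_conj_mult:
  assumes "sq_norm x \<in> {1, -1}"
  shows "sq_conj x \<otimes>\<^bsub>sq_group\<^esub> x = (1, 0, 0, 0)"
proof -
  obtain a b c d where x: "x = (a, b, c, d)" by (cases x)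
  define n where "n = sq_norm x"
  have "n * n = 1" using assms by (auto simp: n_def)
  moreover have "n * (a * a - b * b - c * c + d * d) = n * n" by (simp add: n_def x)
  moreover have "sq_conj x = (n * a, - n * b, - n * c, - n * d)"
    by (simp add: x n_def sq_conj_def Let_def del: sq_norm_simp)
  ultimately show ?thesis by (simp add: x del: sq_norm_simp) (simp add: algebra_simps)
qed

lemma sq_conj_closed:
  assumes "sq_norm x \<in> {1, -1}"
  shows "sq_norm (sq_conj x) \<in> {1, -1}"
proof -
  have "sq_norm (sq_conj x) * sq_norm x = 1"
    by (simp add: sq_norm_mult[symmetric] sq_conj_mult[OF assms])
  then show ?thesis using assms by auto
qed

lemma group_sq_group: "group sq_group"
proof (rule groupI)
  show "x \<otimes>\<^bsub>sq_group\<^esub> y \<in> carrier sq_group" if "x \<in> carrier sq_group" "y \<in> carrier sq_group" for x y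
    using that sq_norm_closed by simp
  show "\<exists>y\<in>carrier sq_group. y \<otimes>\<^bsub>sq_group\<^esub> x = \<one>\<^bsub>sq_group\<^esub>" if "x \<in> carrier sq_group" for x
    using that sq_conj_mult sq_conj_closed by (intro bexI[of _ "sq_conj x"]) auto
  show "\<one>\<^bsub>sq_group\<^esub> \<otimes>\<^bsub>sq_group\<^esub> x = x" if "x \<in> carrier sq_group" for x
    by (cases x) simp
qed (auto simp: sq_assoc)

interpretation sq: group sq_group by (rule group_sq_group)

lemma sq_inv: "sq_norm x \<in> {1, -1} \<Longrightarrow> inv\<^bsub>sq_group\<^esub> x = sq_conj x"
  using sq_conj_mult[of x] sq_conj_closed[of x] by (intro sq.inv_equality) auto

section \<open>Sanov's free group\<close>

text \<open>The diagonal entries of the matrix are \<open>a + b\<close> and \<open>a - b\<close>.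
  The off-diagonal entries \<open>c + d\<close> and \<open>c - d\<close> have equal parity, so one
  evenness condition covers both.\<close>

definition sanov :: "quad set" where
  "sanov = {(a, b, c, d) |a b c d. sq_norm (a, b, c, d) \<in> {1, -1} \<and>
     4 dvd a + b - 1 \<and> 4 dvd a - b - 1 \<and> even (c + d)}"

lemma sanov_iff: "(a, b, c, d) \<in> sanov \<longleftrightarrow> sq_norm (a, b, c, d) \<in> {1, -1} \<and>
     4 dvd a + b - 1 \<and> 4 dvd a - b - 1 \<and> even (c + d)"
  by (simp add: sanov_def)

lemma sanovE:
  assumes "(a, b, c, d) \<in> sanov"
  obtains k l m where "a + b = 1 + 4 * k" "a - b = 1 + 4 * l" "c + d = 2 * m"
proof -
  have "4 dvd a + b - 1" "4 dvd a - b - 1" "even (c + d)"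
    using assms by (simp_all only: sanov_iff)
  then obtain k l m where "a + b - 1 = 4 * k" "a - b - 1 = 4 * l" "c + d = 2 * m"
    unfolding dvd_def by blast
  then show thesis using that[of k l m] by linarith
qed

text \<open>The determinant is a product of two numbers that are 1 modulo 4 minus a product of two
  even ones, so it is 1 modulo 4 and cannot be -1.\<close>

lemma sanov_norm:
  assumes "x \<in> sanov"
  shows "sq_norm x = 1"
proof -
  obtain a b c d where x: "x = (a, b, c, d)" by (cases x)
  obtain k l m where k: "a + b = 1 + 4 * k" and l: "a - b = 1 + 4 * l" and m: "c + d = 2 * m"
    using sanovE[OF assms[unfolded x]] by blast
  have "sq_norm x = (a + b) * (a - b) - (c + d) * (c - d)" by (simp add: x algebra_simps)
  also have "c - d = 2 * m - 2 * d" using m by simp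
  also note k also note l also note m
  also have "(1 + 4 * k) * (1 + 4 * l) - 2 * m * (2 * m - 2 * d) = 1 + 4 * (k + l + 4 * k * l - m * (m - d))" by (simp add: algebra_simps)
  finally have "4 dvd sq_norm x - 1" by simp
  moreover have "sq_norm x \<in> {1, -1}" using assms by (simp add: x sanov_iff)
  ultimately show ?thesis by auto
qed

lemma subgroup_sanov: "subgroup sanov sq_group"
proof (rule sq.subgroupI)
  show "sanov \<subseteq> carrier sq_group" by (auto simp: sanov_def)
  show "sanov \<noteq> {}" using sanov_iff[of 1 0 0 0] by auto
  show "inv\<^bsub>sq_group\<^esub> x \<in> sanov" if "x \<in> sanov" for x
  proof -
    obtain a b c d where x: "x = (a, b, c, d)" by (cases x)
    have "sq_norm x = 1" by (rule sanov_norm[OF that])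
    then show ?thesis using that by (simp add: sq_inv sq_conj_def x sanov_iff)
  qed
  show "x \<otimes>\<^bsub>sq_group\<^esub> y \<in> sanov" if "x \<in> sanov" "y \<in> sanov" for x y
  proof -
    obtain a b c d where x: "x = (a, b, c, d)" by (cases x)
    obtain a' b' c' d' where y: "y = (a', b', c', d')" by (cases y)
    note x_in = that(1)[unfolded x] and y_in = that(2)[unfolded y]
    obtain a'' b'' c'' d'' where xy: "x \<otimes>\<^bsub>sq_group\<^esub> y = (a'', b'', c'', d'')"
      by (cases "x \<otimes>\<^bsub>sq_group\<^esub> y")
    obtain k l m where k: "a + b = 1 + 4 * k" and l: "a - b = 1 + 4 * l" and m: "c + d = 2 * m"
      using sanovE[OF x_in] by blast
    obtain k' l' m' where k': "a' + b' = 1 + 4 * k'" and l': "a' - b' = 1 + 4 * l'"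
      and m': "c' + d' = 2 * m'"
      using sanovE[OF y_in] by blast
    \<comment> \<open>This equation and the two parallel ones below are entries of the product
      matrix.\<close>
    have "a'' + b'' = (a + b) * (a' + b') + (c + d) * (c' - d')"
      using xy by (auto simp: x y algebra_simps)
    also have "c' - d' = 2 * m' - 2 * d'" using m' by simp
    also note k also note k' also note m
    also have "(1 + 4 * k) * (1 + 4 * k') + 2 * m * (2 * m' - 2 * d') = 1 + 4 * (k + k' + 4 * k * k' + m * (m' - d'))" by (simp add: algebra_simps)
    finally have 1: "4 dvd a'' + b'' - 1" by simp
    have "a'' - b'' = (a - b) * (a' - b') + (c - d) * (c' + d')"
      using xy by (auto simp: x y algebra_simps)
    also have "c - d = 2 * m - 2 * d" using m by simp
    also note l also note l' also note m'
    also have "(1 + 4 * l) * (1 + 4 * l') + (2 * m - 2 * d) * (2 * m') = 1 + 4 * (l + l' + 4 * l * l' + (m - d) * m')" by (simp add: algebra_simps)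
    finally have 2: "4 dvd a'' - b'' - 1" by simp
    have "c'' + d'' = (a + b) * (c' + d') + (c + d) * (a' - b')"
      using xy by (auto simp: x y algebra_simps)
    then have 3: "even (c'' + d'')" by (simp add: m m')
    have "sq_norm (x \<otimes>\<^bsub>sq_group\<^esub> y) \<in> {1, -1}"
      using that by (intro sq_norm_closed) (auto simp: sanov_def)
    then show ?thesis using 1 2 3 by (simp add: xy sanov_iff)
  qed
qed

section \<open>Freeness of the two Sanov generators by ping-pong\<close>

text \<open>The elementary matrices with entry 2 in the upper right and in the lower left
  corner.\<close>

definition sanov_gen :: "nat \<Rightarrow> quad" where
  "sanov_gen s = (if s = 0 then (1, 0, 1, 1) else (1, 0, 1, -1))"

lemma sanov_gen_in: "sanov_gen s \<in> sanov"
  by (simp add: sanov_gen_def sanov_iff)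

lemma sanov_gen_inv: "inv\<^bsub>sq_group\<^esub> sanov_gen s = (if s = 0 then (1, 0, -1, -1) else (1, 0, -1, 1))"
  by (simp add: sq_inv sanov_gen_def sq_conj_def)

definition mat_act :: "quad \<Rightarrow> int \<times> int \<Rightarrow> int \<times> int" where
  "mat_act = (\<lambda>(a, b, c, d) (u, v). ((a + b) * u + (c + d) * v, (c - d) * u + (a - b) * v))"

lemma mat_act_mult: "mat_act (x \<otimes>\<^bsub>sq_group\<^esub> y) v = mat_act x (mat_act y v)"
  by (cases x; cases y; cases v) (simp add: mat_act_def algebra_simps)

text \<open>With \<open>x = u / v\<close>, the four regions are \<open>x > 1\<close>, \<open>x < -1\<close>, \<open>0 < x < 1\<close> and \<open>-1 < x < 0\<close>, one for
  each letter.\<close>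

definition ping_pong :: "nat \<times> bool \<Rightarrow> int \<times> int \<Rightarrow> bool" where
  "ping_pong = (\<lambda>(s, e) (u, v).
     let (u, v) = (if s = 0 then (u, v) else (v, u)); u = (if e then - u else u)
     in 0 < v \<and> v < u \<or> v < 0 \<and> u < v)"

text \<open>A letter maps every region other than that of its inverse into its own region, so
  reducedness carries the induction. The start vector depends on the last letter:
  \<open>(0, 1)\<close> for the upper generator, \<open>(1, 0)\<close> for the lower one.\<close>

lemma ping_pong_word:
  assumes "reduced w" "w \<noteq> []" "fst ` set w \<subseteq> {..<2}"
  shows "\<exists>v\<in>{(1, 0), (0, 1)}. ping_pong (hd w) (mat_act (word_eval sq_group sanov_gen w) v)"
  using assms
proof (induction w)
  case (Cons l w)
  obtain s e where l: "l = (s, e)" "s < 2" using Cons.prems by (cases l) auto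
  show ?case
  proof (cases w)
    case Nil
    then show ?thesis using l
      by (auto simp: word_eval_Cons sanov_gen_def sq_inv sq_conj_def ping_pong_def mat_act_def Let_def)
  next
    case (Cons k w')
    have "reduced w" "fst ` set w \<subseteq> {..<2}" "l \<noteq> inv_letter k"
      using Cons.prems Cons by (auto simp: reduced_def)
    then obtain v where v: "v \<in> {(1, 0), (0, 1)}"
      "ping_pong k (mat_act (word_eval sq_group sanov_gen w) v)"
      using Cons.IH Cons by auto
    obtain t e' where k: "k = (t, e')" "t < 2" using Cons.prems Cons by (cases k) auto
    obtain y z where yz: "mat_act (word_eval sq_group sanov_gen w) v = (y, z)" by fastforce
    have st: "s = 0 \<or> s = 1" "t = 0 \<or> t = 1" using l k by auto
    have "ping_pong l (mat_act (word_eval sq_group sanov_gen (l # w)) v)"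
      using v(2) st \<open>l \<noteq> inv_letter k\<close> unfolding yz word_eval_Cons mat_act_mult
      by (auto simp: l k sanov_gen_def sq_inv sq_conj_def ping_pong_def mat_act_def Let_def inv_letter_def split: if_splits)
    then show ?thesis using v(1) by auto
  qed
qed simp

text \<open>The identity fixes \<open>(1, 0)\<close> and \<open>(0, 1)\<close>, which lie in no
  region because the inequalities are strict. So no nonempty reduced word evaluates to the
  identity.\<close>

lemma sanov_word_eval_inj:
  "inj_on (word_eval sq_group sanov_gen) (carrier (free_group {..<2}))"
proof -
  interpret F: group "free_group {..<2::nat}" by (rule group_free_group)
  have "word_eval sq_group sanov_gen \<in> hom (free_group {..<2}) sq_group"
    using sanov_gen_in subgroup.subset[OF subgroup_sanov] by (intro sq.word_eval_hom) auto
  then interpret group_hom "free_group {..<2::nat}" sq_group "word_eval sq_group sanov_gen"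
    by unfold_locales
  have "w = \<one>\<^bsub>free_group {..<2}\<^esub>" if "w \<in> carrier (free_group {..<2})"
    "word_eval sq_group sanov_gen w = \<one>\<^bsub>sq_group\<^esub>" for w
  proof (rule ccontr)
    assume "w \<noteq> \<one>\<^bsub>free_group {..<2}\<^esub>"
    then have "w \<noteq> []" "reduced w" "fst ` set w \<subseteq> {..<2}"
      using that(1) unfolding free_group_def by simp_all
    then obtain v where "v \<in> {(1, 0), (0, 1)}"
      "ping_pong (hd w) (mat_act (word_eval sq_group sanov_gen w) v)"
      using ping_pong_word[of w] by blast
    then show False
      by (cases "hd w") (auto simp: that(2) mat_act_def ping_pong_def Let_def split: if_splits)
  qed
  then show ?thesis by (intro inj_on_one_iff[THEN iffD2]) blast
qed

section \<open>Generation of Sanov's group by Euclidean descent\<close>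

text \<open>If 0 < |r| < |p|, then |p| - 2 |r| lies strictly between -|p| and |p|; the other case is
  symmetric.\<close>

lemma euclid_step:
  fixes p r :: int
  assumes "p \<noteq> 0" "r \<noteq> 0" "\<bar>p\<bar> \<noteq> \<bar>r\<bar>"
  shows "\<bar>p + 2 * r\<bar> < \<bar>p\<bar> \<or> \<bar>p - 2 * r\<bar> < \<bar>p\<bar> \<or> \<bar>r + 2 * p\<bar> < \<bar>r\<bar> \<or> \<bar>r - 2 * p\<bar> < \<bar>r\<bar>"
  using assms by (smt (verit))

text \<open>Descent on the first matrix column \<open>a + b\<close>, \<open>c - d\<close>: left
  multiplication by a generator or its inverse adds twice one entry, up to sign, to the other. The
  subgroup \<open>I\<close> will be the image of the free group.\<close>

lemma sanov_generated:
  assumes I: "subgroup I sq_group" "sanov_gen 0 \<in> I" "sanov_gen 1 \<in> I"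
    and "x \<in> sanov"
  shows "x \<in> I"
  using assms(4)
proof (induction "case x of (a, b, c, d) \<Rightarrow> nat (\<bar>a + b\<bar> + \<bar>c - d\<bar>)" arbitrary: x rule: less_induct)
  case less
  obtain a b c d where x: "x = (a, b, c, d)" by (cases x)
  have gens: "(1, 0, 1, 1) \<in> I" "(1, 0, 1, -1) \<in> I" "(1, 0, -1, -1) \<in> I" "(1, 0, -1, 1) \<in> I"
    using I(2,3) subgroup.m_inv_closed[OF I(1) I(2)] subgroup.m_inv_closed[OF I(1) I(3)]
    unfolding sanov_gen_inv by (simp_all add: sanov_gen_def)
  have step: "x \<in> I" if "y \<in> I" "y \<in> sanov"
    "case y \<otimes>\<^bsub>sq_group\<^esub> x of (a, b, c, d) \<Rightarrow> \<bar>a + b\<bar> + \<bar>c - d\<bar> < \<bar>a' + b'\<bar> + \<bar>c' - d'\<bar>"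
    "x = (a', b', c', d')" for y a' b' c' d'
  proof -
    have "x \<in> carrier sq_group" "y \<in> carrier sq_group"
      using that(2) less.prems subgroup.subset[OF subgroup_sanov] by blast+
    then have "x = inv\<^bsub>sq_group\<^esub> y \<otimes>\<^bsub>sq_group\<^esub> (y \<otimes>\<^bsub>sq_group\<^esub> x)"
      by (simp only: sq.m_assoc[symmetric] sq.inv_closed sq.l_inv sq.l_one)
    moreover have "y \<otimes>\<^bsub>sq_group\<^esub> x \<in> I"
    proof (rule less.hyps)
      show "y \<otimes>\<^bsub>sq_group\<^esub> x \<in> sanov"
        by (rule subgroup.m_closed[OF subgroup_sanov that(2) less.prems])
      show "(case y \<otimes>\<^bsub>sq_group\<^esub> x of (a, b, c, d) \<Rightarrow> nat (\<bar>a + b\<bar> + \<bar>c - d\<bar>))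
          < (case x of (a, b, c, d) \<Rightarrow> nat (\<bar>a + b\<bar> + \<bar>c - d\<bar>))"
        using that(3) unfolding that(4) by (cases "y \<otimes>\<^bsub>sq_group\<^esub> (a', b', c', d')") auto
    qed
    ultimately show ?thesis
      using that(1) subgroup.m_closed[OF I(1)] subgroup.m_inv_closed[OF I(1)] by metis
  qed
  have gens_sanov: "(1, 0, 1, 1) \<in> sanov" "(1, 0, 1, -1) \<in> sanov" "(1, 0, -1, -1) \<in> sanov"
    "(1, 0, -1, 1) \<in> sanov" by (simp_all add: sanov_iff)
  have p: "4 dvd a + b - 1" "4 dvd a - b - 1" "even (c + d)"
    using less.prems by (auto simp: x sanov_iff)
  show ?case
  proof (cases "c = d")
    case True
    \<comment> \<open>The matrix is upper triangular of determinant 1, and the condition modulo 4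
      excludes diagonal entries -1. It is therefore a power of the first generator.\<close>
    have "(a + b) * (a - b) = 1"
      using sanov_norm[OF less.prems] by (simp add: x True algebra_simps)
    then have "a + b = 1 \<and> a - b = 1"
      using p by (auto simp: zmult_eq_1_iff)
    then have "a = 1" "b = 0" by auto
    have pos: "(1, 0, int n, int n) \<in> I" for n
    proof (induction n)
      case (Suc n)
      show ?case using subgroup.m_closed[OF I(1) gens(1) Suc] by (simp add: algebra_simps)
    qed (use subgroup.one_closed[OF I(1)] in simp)
    have neg: "(1, 0, - int n, - int n) \<in> I" for n
    proof (induction n)
      case (Suc n)
      show ?case using subgroup.m_closed[OF I(1) gens(3) Suc] by (simp add: algebra_simps)
    qed (use subgroup.one_closed[OF I(1)] in simp)
    show ?thesis
      using pos neg \<open>a = 1\<close> \<open>b = 0\<close> True by (cases d) (auto simp: x simp del: of_nat_Suc)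
  next
    case False
    \<comment> \<open>\<open>a + b\<close> is odd and \<open>c - d\<close> is even, so the absolute
      values differ.\<close>
    have "a + b \<noteq> 0" "\<bar>a + b\<bar> \<noteq> \<bar>c - d\<bar>" using p by presburger+
    then consider "\<bar>a + b + 2 * (c - d)\<bar> < \<bar>a + b\<bar>" | "\<bar>a + b - 2 * (c - d)\<bar> < \<bar>a + b\<bar>"
      | "\<bar>c - d + 2 * (a + b)\<bar> < \<bar>c - d\<bar>" | "\<bar>c - d - 2 * (a + b)\<bar> < \<bar>c - d\<bar>"
      using False euclid_step[of "a + b" "c - d"] by auto
    then show ?thesis
    proof cases
      case 1
      show ?thesis by (rule step[OF gens(1) gens_sanov(1) _ x]) (use 1 in \<open>simp add: x algebra_simps\<close>)
    next
      case 2
      show ?thesis by (rule step[OF gens(3) gens_sanov(3) _ x]) (use 2 in \<open>simp add: x algebra_simps\<close>)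
    next
      case 3
      show ?thesis by (rule step[OF gens(2) gens_sanov(2) _ x]) (use 3 in \<open>simp add: x algebra_simps\<close>)
    next
      case 4
      show ?thesis by (rule step[OF gens(4) gens_sanov(4) _ x]) (use 4 in \<open>simp add: x algebra_simps\<close>)
    qed
  qed
qed

lemma sanov_free: "sq_group\<lparr>carrier := sanov\<rparr> \<cong> free_group {..<2::nat}"
proof -
  interpret F: group "free_group {..<2::nat}" by (rule group_free_group)
  let ?e = "word_eval sq_group sanov_gen"
  have hom: "?e \<in> hom (free_group {..<2}) sq_group"
    using sanov_gen_in subgroup.subset[OF subgroup_sanov] by (intro sq.word_eval_hom) auto
  then interpret group_hom "free_group {..<2::nat}" sq_group ?e
    by unfold_locales
  have "?e w \<in> sanov" if "w \<in> carrier (free_group {..<2})" for w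
    using sq.word_eval_in_subgroup[OF subgroup_sanov, of sanov_gen "{..<2}" w] that sanov_gen_in
    by (auto simp: free_group_def)
  moreover have "x \<in> ?e ` carrier (free_group {..<2})" if "x \<in> sanov" for x
  proof (rule sanov_generated[OF img_is_subgroup _ _ that])
    have "?e [(s, False)] = sanov_gen s" for s
      using subsetD[OF subgroup.subset[OF subgroup_sanov] sanov_gen_in] by (rule sq.word_eval_generator)
    then show "sanov_gen 0 \<in> ?e ` carrier (free_group {..<2})"
      "sanov_gen 1 \<in> ?e ` carrier (free_group {..<2})"
      using imageI[OF generator_in_free_group[of _ "{..<2}" False], of _ ?e] by force+
  qed
  ultimately have "?e ` carrier (free_group {..<2}) = sanov" by auto
  then have "?e \<in> iso (free_group {..<2}) (sq_group\<lparr>carrier := sanov\<rparr>)"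
    using hom sanov_word_eval_inj by (auto simp: iso_def hom_def bij_betw_def)
  then show ?thesis
    using F.iso_sym by (auto simp: is_iso_def)
qed

section \<open>Congruence subgroups\<close>

text \<open>\<open>f\<close> separates exactly the right cosets, so they are its fibres and the
  index becomes a count of values.\<close>

lemma (in group) card_rcosets_eq_card_image:
  assumes "subgroup H G"
    and f: "\<And>x y. x \<in> carrier G \<Longrightarrow> y \<in> carrier G \<Longrightarrow> f x = f y \<longleftrightarrow> x \<otimes> inv y \<in> H"
  shows "card (rcosets H) = card (f ` carrier G)"
proof -
  interpret H: subgroup H G by fact
  have fibre: "H #> y = {x \<in> carrier G. f x = f y}" if "y \<in> carrier G" for y
    using that f by (auto simp: r_coset_def) (metis H.mem_carrier inv_solve_right' m_closed, metis inv_solve_right H.mem_carrier)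
  define F where "F z = {x \<in> carrier G. f x = z}" for z
  have "rcosets H = F ` f ` carrier G"
    using fibre by (auto simp: RCOSETS_def F_def)
  moreover have "inj_on F (f ` carrier G)"
    by (auto simp: inj_on_def F_def)
  ultimately show ?thesis by (simp add: card_image)
qed

section \<open>Congruence subgroups and the residue homomorphism\<close>

definition cong_quads :: "int \<Rightarrow> quad set" where
  "cong_quads m = {(1 + m * a, m * b, m * c, m * d) |a b c d.
     sq_norm (1 + m * a, m * b, m * c, m * d) \<in> {1, -1}}"

lemma cong_quads_iff:
  "(a, b, c, d) \<in> cong_quads m \<longleftrightarrow>
     sq_norm (a, b, c, d) \<in> {1, -1} \<and> m dvd a - 1 \<and> m dvd b \<and> m dvd c \<and> m dvd d"
proof
  assume "sq_norm (a, b, c, d) \<in> {1, -1} \<and> m dvd a - 1 \<and> m dvd b \<and> m dvd c \<and> m dvd d"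
  then obtain a' b' c' d' where "a - 1 = m * a'" "b = m * b'" "c = m * c'" "d = m * d'"
    unfolding dvd_def by blast
  moreover from this have "a = 1 + m * a'" by linarith
  ultimately show "(a, b, c, d) \<in> cong_quads m"
    using \<open>sq_norm (a, b, c, d) \<in> {1, -1} \<and> _\<close> by (auto simp: cong_quads_def simp del: sq_norm_simp)
qed (auto simp: cong_quads_def)

lemma cong_quadsE:
  assumes "x \<in> cong_quads m"
  obtains a b c d where "x = (1 + m * a, m * b, m * c, m * d)"
  using assms by (auto simp: cong_quads_def)

text \<open>For \<open>m = 2 * n\<close> the norm is 1 modulo 4, which rules out -1.\<close>

lemma cong_quads_norm:
  assumes "x \<in> cong_quads m" "even m"
  shows "sq_norm x = 1"
proof -
  obtain a b c d where x: "x = (1 + m * a, m * b, m * c, m * d)"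
    using assms(1) by (rule cong_quadsE)
  obtain n where n: "m = 2 * n" using assms(2) by blast
  have "sq_norm x = 1 + 4 * (n * a + n * n * (a * a - b * b - c * c + d * d))"
    by (simp add: x n algebra_simps)
  moreover have "sq_norm x \<in> {1, -1}" using assms(1) by (simp only: x cong_quads_iff)
  ultimately show ?thesis by auto presburger
qed

text \<open>Norm 1 of 1 + m u, expanded and divided by \<open>m\<close>. The constraints on the
  residue of u come from this relation.\<close>

lemma cong_quads_norm_eq:
  assumes "(1 + m * a, m * b, m * c, m * d) \<in> cong_quads m" "even m" "m \<noteq> 0"
  shows "2 * a + m * (a * a - b * b - c * c + d * d) = 0"
proof -
  have "m * (2 * a + m * (a * a - b * b - c * c + d * d)) = 0"
    using cong_quads_norm[OF assms(1,2)] by (simp add: algebra_simps)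
  then show ?thesis using assms(3) by simp
qed

lemma subgroup_cong_quads:
  assumes "even m"
  shows "subgroup (cong_quads m) sq_group"
proof (rule sq.subgroupI)
  show "cong_quads m \<subseteq> carrier sq_group" by (auto simp: cong_quads_def)
  show "cong_quads m \<noteq> {}" using cong_quads_iff[of 1 0 0 0 m] by auto
  show "inv\<^bsub>sq_group\<^esub> x \<in> cong_quads m" if "x \<in> cong_quads m" for x
  proof -
    obtain a b c d where x: "x = (a, b, c, d)" by (cases x)
    have "sq_norm x = 1" by (rule cong_quads_norm[OF that assms])
    then show ?thesis using that by (simp add: sq_inv sq_conj_def x cong_quads_iff)
  qed
  show "x \<otimes>\<^bsub>sq_group\<^esub> y \<in> cong_quads m" if "x \<in> cong_quads m" "y \<in> cong_quads m" for x y
  proof -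
    note x_in = that(1) and y_in = that(2)
    obtain a b c d where x: "x = (1 + m * a, m * b, m * c, m * d)"
      using x_in by (rule cong_quadsE)
    obtain a' b' c' d' where y: "y = (1 + m * a', m * b', m * c', m * d')"
      using y_in by (rule cong_quadsE)
    \<comment> \<open>This is (1 + m u)(1 + m v) = 1 + m (u + v + m u v).\<close>
    have xy: "x \<otimes>\<^bsub>sq_group\<^esub> y =
      (1 + m * (a + a' + m * (a * a' + b * b' + c * c' - d * d')),
       m * (b + b' + m * (a * b' + b * a' - c * d' + d * c')),
       m * (c + c' + m * (a * c' + c * a' + b * d' - d * b')),
       m * (d + d' + m * (a * d' + d * a' + b * c' - c * b')))"
      by (simp add: x y algebra_simps)
    have "sq_norm (x \<otimes>\<^bsub>sq_group\<^esub> y) \<in> {1, -1}"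
      using that by (intro sq_norm_closed) (auto simp: cong_quads_def)
    then show ?thesis unfolding xy cong_quads_iff by simp
  qed
qed

text \<open>\<open>digits m (1 + m u)\<close> is the residue of \<open>u\<close> modulo \<open>2\<close>.\<close>

definition digits :: "int \<Rightarrow> quad \<Rightarrow> bool \<times> bool \<times> bool \<times> bool" where
  "digits m = (\<lambda>(a, b, c, d). (odd ((a - 1) div m), odd (b div m), odd (c div m), odd (d div m)))"

fun xor4 :: "bool \<times> bool \<times> bool \<times> bool \<Rightarrow> bool \<times> bool \<times> bool \<times> bool \<Rightarrow> bool \<times> bool \<times> bool \<times> bool" where
  "xor4 (a, b, c, d) (a', b', c', d') = (a \<noteq> a', b \<noteq> b', c \<noteq> c', d \<noteq> d')"

lemma digits_simp:
  "m \<noteq> 0 \<Longrightarrow> digits m (1 + m * a, m * b, m * c, m * d) = (odd a, odd b, odd c, odd d)"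
  by (simp add: digits_def)

text \<open>In 1 + m (u + v + m u v) the last term vanishes modulo 2 because \<open>m\<close> is
  even, so residues add.\<close>

lemma digits_mult:
  assumes "x \<in> cong_quads m" "y \<in> cong_quads m" "even m" "m \<noteq> 0"
  shows "digits m (x \<otimes>\<^bsub>sq_group\<^esub> y) = xor4 (digits m x) (digits m y)"
proof -
  obtain a b c d where x: "x = (1 + m * a, m * b, m * c, m * d)"
    using assms(1) by (rule cong_quadsE)
  obtain a' b' c' d' where y: "y = (1 + m * a', m * b', m * c', m * d')"
    using assms(2) by (rule cong_quadsE)
  have xy: "x \<otimes>\<^bsub>sq_group\<^esub> y =
    (1 + m * (a + a' + m * (a * a' + b * b' + c * c' - d * d')),
     m * (b + b' + m * (a * b' + b * a' - c * d' + d * c')),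
     m * (c + c' + m * (a * c' + c * a' + b * d' - d * b')),
     m * (d + d' + m * (a * d' + d * a' + b * c' - c * b')))"
    by (simp add: x y algebra_simps)
  show ?thesis
    unfolding xy unfolding x y digits_simp[OF assms(4)] using assms(3) by simp
qed

text \<open>For even u, 1 + m u is 1 + 2 m (u / 2), so the smaller congruence group is the kernel of
  \<open>digits\<close>.\<close>

lemma cong_quads_double:
  assumes "m \<noteq> 0"
  shows "cong_quads (2 * m) = {x \<in> cong_quads m. digits m x = (False, False, False, False)}"
proof (intro subset_antisym subsetI)
  fix x assume x: "x \<in> cong_quads (2 * m)"
  then obtain a b c d where x_eq: "x = (1 + (2 * m) * a, (2 * m) * b, (2 * m) * c, (2 * m) * d)"
    by (rule cong_quadsE)
  then have "x = (1 + m * (2 * a), m * (2 * b), m * (2 * c), m * (2 * d))"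
    by (simp add: ac_simps)
  moreover have "sq_norm x \<in> {1, -1}" using x unfolding x_eq cong_quads_iff by blast
  ultimately show "x \<in> {x \<in> cong_quads m. digits m x = (False, False, False, False)}"
    using digits_simp[OF assms] by (auto simp: cong_quads_iff simp del: sq_norm_simp)
next
  fix x assume x: "x \<in> {x \<in> cong_quads m. digits m x = (False, False, False, False)}"
  then obtain a b c d where x_eq: "x = (1 + m * a, m * b, m * c, m * d)"
    using cong_quadsE[of x m] by blast
  then have "even a" "even b" "even c" "even d"
    using x digits_simp[OF assms] by auto
  then obtain a' b' c' d' where "a = 2 * a'" "b = 2 * b'" "c = 2 * c'" "d = 2 * d'"
    by (auto elim!: evenE)
  moreover have "sq_norm x \<in> {1, -1}" using x unfolding x_eq by (auto simp only: cong_quads_iff mem_Collect_eq)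
  ultimately show "x \<in> cong_quads (2 * m)"
    unfolding x_eq cong_quads_iff by (simp del: sq_norm_simp)
qed

lemma digits_eq_iff:
  assumes "x \<in> cong_quads m" "y \<in> cong_quads m" "even m" "m \<noteq> 0"
  shows "digits m x = digits m y \<longleftrightarrow> x \<otimes>\<^bsub>sq_group\<^esub> inv\<^bsub>sq_group\<^esub> y \<in> cong_quads (2 * m)"
proof -
  interpret C: subgroup "cong_quads m" sq_group by (rule subgroup_cong_quads) fact
  define z where "z = x \<otimes>\<^bsub>sq_group\<^esub> inv\<^bsub>sq_group\<^esub> y"
  have z: "z \<in> cong_quads m" using assms(1,2) C.m_closed C.m_inv_closed z_def by blast
  have "z \<otimes>\<^bsub>sq_group\<^esub> y = x"
    unfolding z_def using assms(1,2) C.subset by (subst sq.m_assoc) (auto simp: subset_iff simp del: sq_group_simps)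
  then have "digits m x = xor4 (digits m z) (digits m y)"
    using digits_mult[OF z assms(2-4)] by simp
  then have "digits m x = digits m y \<longleftrightarrow> digits m z = (False, False, False, False)"
    by (cases "digits m z"; cases "digits m y") auto
  then show ?thesis using z by (simp add: cong_quads_double[OF assms(4)] z_def)
qed

section \<open>The residues that occur\<close>

text \<open>For \<open>m = 4 * t\<close> the norm relation makes \<open>a\<close> equal to -2 t
  times an integer.\<close>

lemma digits_of_4_dvd:
  assumes "x \<in> cong_quads m" "4 dvd m" "m \<noteq> 0"
  shows "\<not> fst (digits m x)"
proof -
  obtain a b c d where x: "x = (1 + m * a, m * b, m * c, m * d)"
    using assms(1) by (rule cong_quadsE)
  obtain t where t: "m = 4 * t" using assms(2) by blast
  have "even m" by (simp add: t)
  have "2 * a + m * (a * a - b * b - c * c + d * d) = 0"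
    using cong_quads_norm_eq[OF assms(1)[unfolded x] \<open>even m\<close> assms(3)] .
  then have "a = 2 * (- t * (a * a - b * b - c * c + d * d))" by (simp add: t)
  then show ?thesis unfolding x digits_simp[OF assms(3)] by (metis dvd_triv_left fst_conv)
qed

text \<open>For modulus 2 the norm relation says that \<open>a\<close> plus the norm of u is 0. As
  \<open>a + a * a\<close> is even and squaring keeps parity, \<open>b + c + d\<close> is
  even.\<close>

lemma digits_of_2:
  assumes "x \<in> cong_quads 2" "digits 2 x = (p, q, r, s)"
  shows "q = (r \<noteq> s)"
proof -
  obtain a b c d where x: "x = (1 + 2 * a, 2 * b, 2 * c, 2 * d)"
    using assms(1) by (rule cong_quadsE)
  have "2 * a + 2 * (a * a - b * b - c * c + d * d) = 0"
    using cong_quads_norm_eq[OF assms(1)[unfolded x]] by simp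
  then have "2 * (a + (a * a - b * b - c * c + d * d)) = 0" by (simp only: distrib_left)
  then have "a + (a * a - b * b - c * c + d * d) = 0" by simp
  then have "even (a + (a * a - b * b - c * c + d * d))" by simp
  then have "even (b + c + d)" by auto
  then show ?thesis using assms(2) unfolding x by (auto simp: digits_simp)
qed

text \<open>The nilpotent elements \<open>i + k\<close> and \<open>j + k\<close> give units \<open>1 + m (i + k)\<close> and \<open>1 + m (j + k)\<close>, whose
  residues have even weight. For the remaining residues take the matrix with rows
  \<open>(1 + m, 2 m)\<close> and \<open>(m\<^sup>2 / 2, 1 - m + m\<^sup>2)\<close>, where \<open>m = 4 t\<close>.\<close>

definition mixed_unit :: "int \<Rightarrow> quad" where
  "mixed_unit t = (1 + 4 * t * (2 * t), 4 * t * (1 - 2 * t), 4 * t * (1 + t), 4 * t * (1 - t))"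

lemma cong_quads_witnesses:
  shows "(1, m, 0, m) \<in> cong_quads m" "(1, 0, m, m) \<in> cong_quads m"
    "mixed_unit t \<in> cong_quads (4 * t)" "(-1, 0, 0, 0) \<in> cong_quads 2"
  by (simp_all add: cong_quads_iff mixed_unit_def algebra_simps)

lemma digits_witnesses:
  assumes "m \<noteq> 0"
  shows "digits m (1, m, 0, m) = (False, True, False, True)"
    "digits m (1, 0, m, m) = (False, False, True, True)"
    "t \<noteq> 0 \<Longrightarrow> digits (4 * t) (mixed_unit t) = (False, True, even t, even t)"
    "digits 2 (-1, 0, 0, 0) = (True, False, False, False)"
  using assms by (simp_all add: digits_def mixed_unit_def)

text \<open>The values are closed under \<open>xor4\<close>, and three independent witnesses
  generate all residues with even first coordinate, the only ones that
  \<open>digits_of_4_dvd\<close> allows.\<close>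

lemma digits_image_4_dvd:
  assumes "4 dvd m" "m \<noteq> 0"
  shows "digits m ` cong_quads m = {False} \<times> UNIV"
proof -
  obtain t where m: "m = 4 * t" using assms(1) by blast
  then have t: "t \<noteq> 0" "even m" using assms(2) by auto
  interpret C: subgroup "cong_quads m" sq_group by (rule subgroup_cong_quads) fact
  have mult: "xor4 v w \<in> digits m ` cong_quads m"
    if vw: "v \<in> digits m ` cong_quads m" "w \<in> digits m ` cong_quads m" for v w
  proof -
    obtain x y where xy: "x \<in> cong_quads m" "y \<in> cong_quads m" "v = digits m x" "w = digits m y"
      using vw by blast
    then have "xor4 v w = digits m (x \<otimes>\<^bsub>sq_group\<^esub> y)"
      using digits_mult[OF xy(1,2)] t(2) assms(2) by simp
    then show ?thesis using C.m_closed[OF xy(1,2)] by blast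
  qed
  have 1: "(False, True, False, True) \<in> digits m ` cong_quads m"
    using cong_quads_witnesses(1)[of m] digits_witnesses(1)[OF assms(2)] by (metis imageI)
  have 2: "(False, False, True, True) \<in> digits m ` cong_quads m"
    using cong_quads_witnesses(2)[of m] digits_witnesses(2)[OF assms(2)] by (metis imageI)
  have 3: "(False, True, even t, even t) \<in> digits m ` cong_quads m"
    using cong_quads_witnesses(3)[of t] digits_witnesses(3)[OF assms(2) t(1)] m by (metis imageI)
  \<comment> \<open>For even \<open>t\<close> the mixed unit has residue (0, 1, 1, 1), and adding
    that of 1 + m (j + k) leaves (0, 1, 0, 0); for odd \<open>t\<close> it has this residue
    already.\<close>
  have 4: "(False, True, False, False) \<in> digits m ` cong_quads m"
    using 3 mult[OF 3 2] by (cases "even t") auto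
  have "(False, q, r, s) \<in> digits m ` cong_quads m" for q r s
    using 1 2 4 mult[OF 1 2] mult[OF 1 4] mult[OF 2 4] mult[OF mult[OF 1 2] 4] mult[OF 1 1]
    by (cases q; cases r; cases s) auto
  then have "{False} \<times> UNIV \<subseteq> digits m ` cong_quads m" by auto
  moreover have "digits m ` cong_quads m \<subseteq> {False} \<times> UNIV"
  proof (rule image_subsetI)
    fix x assume "x \<in> cong_quads m"
    then have "\<not> fst (digits m x)" by (rule digits_of_4_dvd[OF _ assms])
    then show "digits m x \<in> {False} \<times> UNIV" by (cases "digits m x") simp
  qed
  ultimately show ?thesis by blast
qed

text \<open>Here -1 = 1 + 2 (-1) supplies an odd first coordinate; with the two unipotent witnesses
  it generates everything that \<open>digits_of_2\<close> allows.\<close>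

lemma digits_image_2:
  "digits 2 ` cong_quads 2 = {(p, q, r, s). q = (r \<noteq> s)}"
proof -
  interpret C: subgroup "cong_quads 2" sq_group by (rule subgroup_cong_quads) simp
  have mult: "xor4 v w \<in> digits 2 ` cong_quads 2"
    if vw: "v \<in> digits 2 ` cong_quads 2" "w \<in> digits 2 ` cong_quads 2" for v w
  proof -
    obtain x y where xy: "x \<in> cong_quads 2" "y \<in> cong_quads 2" "v = digits 2 x" "w = digits 2 y"
      using vw by blast
    then have "xor4 v w = digits 2 (x \<otimes>\<^bsub>sq_group\<^esub> y)"
      using digits_mult[OF xy(1,2)] by simp
    then show ?thesis using C.m_closed[OF xy(1,2)] by blast
  qed
  have 1: "(False, True, False, True) \<in> digits 2 ` cong_quads 2"
    using cong_quads_witnesses(1)[of 2] digits_witnesses(1)[of 2] by (metis imageI zero_neq_numeral)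
  have 2: "(False, False, True, True) \<in> digits 2 ` cong_quads 2"
    using cong_quads_witnesses(2)[of 2] digits_witnesses(2)[of 2] by (metis imageI zero_neq_numeral)
  have 3: "(True, False, False, False) \<in> digits 2 ` cong_quads 2"
    using cong_quads_witnesses(4) digits_witnesses(4)[of 2] by (metis imageI zero_neq_numeral)
  have "(p, r \<noteq> s, r, s) \<in> digits 2 ` cong_quads 2" for p r s
    using 1 2 3 mult[OF 1 2] mult[OF 1 3] mult[OF 2 3] mult[OF mult[OF 1 2] 3] mult[OF 1 1]
    by (cases p; cases r; cases s) auto
  moreover have "digits 2 ` cong_quads 2 \<subseteq> {(p, q, r, s). q = (r \<noteq> s)}"
  proof (rule image_subsetI)
    fix x assume x: "x \<in> cong_quads 2"
    obtain p q r s where "digits 2 x = (p, q, r, s)" by (cases "digits 2 x")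
    then show "digits 2 x \<in> {(p, q, r, s). q = (r \<noteq> s)}" using digits_of_2[OF x] by simp
  qed
  ultimately show ?thesis by blast
qed

lemma card_digits_image:
  assumes "m = 2 \<or> 4 dvd m" "m \<noteq> 0"
  shows "card (digits m ` cong_quads m) = 8"
proof (cases "4 dvd m")
  case True
  then show ?thesis
    by (simp add: digits_image_4_dvd assms(2) card_cartesian_product UNIV_Times_UNIV[symmetric] del: UNIV_Times_UNIV)
next
  case False
  \<comment> \<open>Three free bits determine the fourth; the constant factor pads the parameters to
    quadruples.\<close>
  have "{(p :: bool, q, r, s). q = (r \<noteq> s)} = (\<lambda>(p, q, r, s). (p, q, r, q \<noteq> r)) ` (UNIV \<times> UNIV \<times> UNIV \<times> {True})"
    by (auto simp: image_iff)
  also have "card \<dots> = 8"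
    by (subst card_image) (auto simp: inj_on_def card_cartesian_product card_UNIV_bool)
  finally show ?thesis using False assms(1) digits_image_2 by simp
qed

section \<open>The quotient of the unit group by U_1\<close>

definition par4 :: "quad \<Rightarrow> bool \<times> bool \<times> bool \<times> bool" where
  "par4 = (\<lambda>(a, b, c, d). (odd a, odd b, odd c, odd d))"

text \<open>A unit y stays invertible modulo 2, so x and y agree modulo 2 exactly when x y^-1 is 1
  modulo 2. The two directions reduce z = x y^-1 and x = z y.\<close>

lemma par4_eq_iff:
  assumes "sq_norm x \<in> {1, -1}" "sq_norm y \<in> {1, -1}"
  shows "par4 x = par4 y \<longleftrightarrow> x \<otimes>\<^bsub>sq_group\<^esub> inv\<^bsub>sq_group\<^esub> y \<in> cong_quads 2"
proof -
  obtain a b c d where x: "x = (a, b, c, d)" by (cases x)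
  obtain a' b' c' d' where y: "y = (a', b', c', d')" by (cases y)
  define z where "z = x \<otimes>\<^bsub>sq_group\<^esub> inv\<^bsub>sq_group\<^esub> y"
  obtain e f g h where z: "z = (e, f, g, h)" by (cases z)
  have xc: "x \<in> carrier sq_group" and yc: "y \<in> carrier sq_group" using assms by simp_all
  define n where "n = sq_norm y"
  have n: "odd n" "odd (sq_norm y)" using assms(2) by (auto simp: n_def)
  have "z = x \<otimes>\<^bsub>sq_group\<^esub> (n * a', - n * b', - n * c', - n * d')"
    using assms(2) unfolding z_def sq_inv[OF assms(2)] by (simp add: sq_conj_def Let_def y n_def del: sq_norm_simp sq_group_simps)
  then have zx: "(e, f, g, h) = (a, b, c, d) \<otimes>\<^bsub>sq_group\<^esub> (n * a', - n * b', - n * c', - n * d')"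
    by (simp only: x z)
  have xz: "(a, b, c, d) = (e, f, g, h) \<otimes>\<^bsub>sq_group\<^esub> (a', b', c', d')"
    unfolding x[symmetric] y[symmetric] z[symmetric] z_def
    by (simp only: sq.m_assoc[OF xc sq.inv_closed[OF yc] yc] sq.l_inv[OF yc] sq.r_one[OF xc])
  have "z \<in> carrier sq_group" unfolding z_def using xc yc by (intro sq.m_closed sq.inv_closed)
  then have nz: "sq_norm (e, f, g, h) \<in> {1, -1}" by (simp add: z)
  have "par4 x = par4 y \<longleftrightarrow> 2 dvd e - 1 \<and> 2 dvd f \<and> 2 dvd g \<and> 2 dvd h"
  proof
    assume "par4 x = par4 y"
    then have "even a = even a'" "even b = even b'" "even c = even c'" "even d = even d'"
      by (simp_all add: x y par4_def)
    then show "2 dvd e - 1 \<and> 2 dvd f \<and> 2 dvd g \<and> 2 dvd h"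
      using zx n
      by (cases "even a'"; cases "even b'"; cases "even c'"; cases "even d'") (simp_all add: y)
  next
    assume "2 dvd e - 1 \<and> 2 dvd f \<and> 2 dvd g \<and> 2 dvd h"
    then show "par4 x = par4 y"
      using xz by (simp add: x y par4_def)
  qed
  then show ?thesis unfolding z_def[symmetric] z cong_quads_iff using nz by blast
qed

text \<open>The norm is odd, so an odd number of coordinates is odd. Each of these eight patterns is
  met by a quadruple with entries 0 and 1.\<close>

lemma par4_image:
  "par4 ` {x. sq_norm x \<in> {1, -1}} =
    {(True, False, False, False), (False, True, False, False), (False, False, True, False),
     (False, False, False, True), (True, True, True, False), (True, True, False, True),
     (True, False, True, True), (False, True, True, True)}" (is "_ = ?B")
proof (intro subset_antisym image_subsetI)
  fix x assume "x \<in> {x. sq_norm x \<in> {1, -1}}"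
  then have "odd (sq_norm x)" by auto
  moreover obtain a b c d where "x = (a, b, c, d)" by (cases x)
  ultimately show "par4 x \<in> ?B"
    by (cases "even a"; cases "even b"; cases "even c"; cases "even d") (simp_all add: par4_def)
next
  let ?W = "{(1, 0, 0, 0), (0, 1, 0, 0), (0, 0, 1, 0), (0, 0, 0, 1), (1, 1, 1, 0), (1, 1, 0, 1),
     (1, 0, 1, 1), (0, 1, 1, 1)} :: quad set"
  have "?B = par4 ` ?W" by (simp add: par4_def)
  also have "\<dots> \<subseteq> par4 ` {x. sq_norm x \<in> {1, -1}}" by (intro image_mono) auto
  finally show "?B \<subseteq> par4 ` {x. sq_norm x \<in> {1, -1}}" .
qed

lemma card_par4_image: "card (par4 ` {x. sq_norm x \<in> {1, -1}}) = 8"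
  unfolding par4_image by simp

section \<open>Free ranks of the congruence subgroups\<close>

lemma cong_quads_double_free:
  assumes m: "4 dvd m" "m \<noteq> 0"
    and free: "sq_group\<lparr>carrier := cong_quads m\<rparr> \<cong> free_group {..<n::nat}"
  shows "sq_group\<lparr>carrier := cong_quads (2 * m)\<rparr> \<cong> free_group {..<8 * n - 7}"
proof -
  obtain t where t: "m = 4 * t" "t \<noteq> 0" using m by (auto elim: dvdE)
  have even: "even m" by (simp add: t)
  \<comment> \<open>The order of the parities fits the witnesses: \<open>p1\<close> is odd on the
    mixed unit; \<open>(1, m, 0, m)\<close> has even \<open>p1\<close> and odd \<open>p2\<close>;
    \<open>(1, 0, m, m)\<close> has \<open>p1\<close> and \<open>p2\<close> even and
    \<open>p3\<close> odd.\<close>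
  define p1 where "p1 x = (case digits m x of (_, q, r, s) \<Rightarrow> q \<noteq> (r \<noteq> s))" for x
  define p2 where "p2 x = (case digits m x of (_, q, r, s) \<Rightarrow> q)" for x
  define p3 where "p3 x = (case digits m x of (_, q, r, s) \<Rightarrow> r)" for x
  define K1 where "K1 = {x \<in> cong_quads m. \<not> p1 x}"
  define K2 where "K2 = {x \<in> K1. \<not> p2 x}"
  have mult: "p1 (x \<otimes>\<^bsub>sq_group\<^esub> y) = (p1 x \<noteq> p1 y)" "p2 (x \<otimes>\<^bsub>sq_group\<^esub> y) = (p2 x \<noteq> p2 y)"
    "p3 (x \<otimes>\<^bsub>sq_group\<^esub> y) = (p3 x \<noteq> p3 y)"
    if "x \<in> cong_quads m" "y \<in> cong_quads m" for x y
    unfolding p1_def p2_def p3_def digits_mult[OF that even m(2)]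
    by (cases "digits m x"; cases "digits m y"; auto)+
  have wit: "(1, m, 0, m) \<in> cong_quads m" "(1, 0, m, m) \<in> cong_quads m" "mixed_unit t \<in> cong_quads m"
    using cong_quads_witnesses t by auto
  have dig: "digits m (1, m, 0, m) = (False, True, False, True)"
    "digits m (1, 0, m, m) = (False, False, True, True)"
    "digits m (mixed_unit t) = (False, True, even t, even t)"
    using digits_witnesses[OF m(2)] t by auto
  have sub0: "subgroup (cong_quads m) sq_group" by (rule subgroup_cong_quads[OF even])
  have sub1: "subgroup K1 sq_group"
    unfolding K1_def by (rule sq.parity_kernel_subgroup[OF sub0 mult(1)])
  have sub2: "subgroup K2 sq_group"
    unfolding K2_def by (rule sq.parity_kernel_subgroup[OF sub1 mult(2)]) (auto simp: K1_def)
  have "sq_group\<lparr>carrier := K1\<rparr> \<cong> free_group {..<2 * n - 1}"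
    unfolding K1_def
    by (rule sq.parity_kernel_free[OF sub0 free mult(1) wit(3)]) (auto simp: p1_def dig)
  then have "sq_group\<lparr>carrier := K2\<rparr> \<cong> free_group {..<2 * (2 * n - 1) - 1}"
    unfolding K2_def
    by (rule sq.parity_kernel_free[OF sub1 _ mult(2), of _ "(1, m, 0, m)"])
      (use wit in \<open>auto simp: K1_def p1_def p2_def dig\<close>)
  then have "sq_group\<lparr>carrier := {x \<in> K2. \<not> p3 x}\<rparr> \<cong> free_group {..<2 * (2 * (2 * n - 1) - 1) - 1}"
    by (rule sq.parity_kernel_free[OF sub2 _ mult(3), of _ "(1, 0, m, m)"])
      (use wit in \<open>auto simp: K2_def K1_def p1_def p2_def p3_def dig\<close>)
  moreover have "{x \<in> K2. \<not> p3 x} = cong_quads (2 * m)"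
    unfolding cong_quads_double[OF m(2)] K2_def K1_def
  proof (intro Collect_cong)
    fix x
    show "(x \<in> {x \<in> {x \<in> cong_quads m. \<not> p1 x}. \<not> p2 x} \<and> \<not> p3 x)
      = (x \<in> cong_quads m \<and> digits m x = (False, False, False, False))"
      using digits_of_4_dvd[OF _ m, of x] by (cases "digits m x") (auto simp: p1_def p2_def p3_def)
  qed
  \<comment> \<open>Subtraction is truncated here; at \<open>n = 0\<close> both sides are 0.\<close>
  moreover have "2 * (2 * (2 * n - 1) - 1) - 1 = 8 * n - 7" by simp
  ultimately show ?thesis by simp
qed

text \<open>The complement of {1, -1} in U_1. The form \<open>\<not> odd\<close> matches
  \<open>parity_kernel_free\<close>.\<close>

definition sanov_even :: "quad set" where
  "sanov_even = {x \<in> sanov. \<not> odd (snd (snd (snd x)))}"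

lemma sanov_parity:
  assumes "(a, b, c, d) \<in> sanov"
  shows "odd a" "even b" "even c = even d"
proof -
  have "4 dvd a + b - 1" "4 dvd a - b - 1" "even (c + d)"
    using assms by (simp_all only: sanov_iff)
  then show "odd a" "even b" "even c = even d" by presburger+
qed

text \<open>In Sanov's group \<open>a\<close> is odd and \<open>b\<close> is even, so last
  coordinates add modulo 2.\<close>

lemma sanov_even_mult:
  assumes "x \<in> sanov" "y \<in> sanov"
  shows "odd (snd (snd (snd (x \<otimes>\<^bsub>sq_group\<^esub> y)))) = (odd (snd (snd (snd x))) \<noteq> odd (snd (snd (snd y))))"
  using assms sanov_parity by (cases x; cases y) auto

lemma subgroup_sanov_even: "subgroup sanov_even sq_group"
  unfolding sanov_even_def by (rule sq.parity_kernel_subgroup[OF subgroup_sanov sanov_even_mult])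

lemma sanov_even_free: "sq_group\<lparr>carrier := sanov_even\<rparr> \<cong> free_group {..<3::nat}"
  using sq.parity_kernel_free[OF subgroup_sanov sanov_free sanov_even_mult sanov_gen_in[of 0]]
  unfolding sanov_even_def by (simp add: sanov_gen_def)

lemma sanov_even_subset: "sanov_even \<subseteq> cong_quads 2"
proof
  fix x assume x: "x \<in> sanov_even"
  obtain a b c d where x_eq: "x = (a, b, c, d)" by (cases x)
  then have "(a, b, c, d) \<in> sanov" "even d" using x by (auto simp: sanov_even_def)
  then show "x \<in> cong_quads 2"
    using sanov_parity[of a b c d] by (simp add: x_eq cong_quads_iff sanov_iff)
qed

text \<open>Start of the rank induction. Two parities on \<open>sanov_even\<close> suffice:
  \<open>digits_of_2\<close> then makes the last digit even, and the condition on
  \<open>a + b\<close> modulo 4 fixes \<open>a\<close>.\<close>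

lemma cong_quads_4_free: "sq_group\<lparr>carrier := cong_quads 4\<rparr> \<cong> free_group {..<9::nat}"
proof -
  define p2 where "p2 x = (case digits 2 x of (_, q, r, s) \<Rightarrow> q)" for x
  define p3 where "p3 x = (case digits 2 x of (_, q, r, s) \<Rightarrow> r)" for x
  define K2 where "K2 = {x \<in> sanov_even. \<not> p2 x}"
  have mult: "p2 (x \<otimes>\<^bsub>sq_group\<^esub> y) = (p2 x \<noteq> p2 y)" "p3 (x \<otimes>\<^bsub>sq_group\<^esub> y) = (p3 x \<noteq> p3 y)"
    if "x \<in> sanov_even" "y \<in> sanov_even" for x y
  proof -
    have "digits 2 (x \<otimes>\<^bsub>sq_group\<^esub> y) = xor4 (digits 2 x) (digits 2 y)"
      using that sanov_even_subset by (intro digits_mult) auto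
    then show "p2 (x \<otimes>\<^bsub>sq_group\<^esub> y) = (p2 x \<noteq> p2 y)" "p3 (x \<otimes>\<^bsub>sq_group\<^esub> y) = (p3 x \<noteq> p3 y)"
      unfolding p2_def p3_def by (cases "digits 2 x"; cases "digits 2 y"; auto)+
  qed
  \<comment> \<open>The first witness is the negative of \<open>(1, 2, 0, 2)\<close>, with the sign
    chosen so that \<open>a + b\<close> is 1 modulo 4.\<close>
  have wit: "(-1, -2, 0, -2) \<in> sanov_even" "(1, 0, 2, 2) \<in> sanov_even"
    by (simp_all add: sanov_even_def sanov_iff)
  have dig: "digits 2 (-1, -2, 0, -2) = (True, True, False, True)"
    "digits 2 (1, 0, 2, 2) = (False, False, True, True)"
    by (simp_all add: digits_def)
  have sub2: "subgroup K2 sq_group"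
    unfolding K2_def by (rule sq.parity_kernel_subgroup[OF subgroup_sanov_even mult(1)])
  have "sq_group\<lparr>carrier := K2\<rparr> \<cong> free_group {..<2 * 3 - 1 :: nat}"
    unfolding K2_def
    by (rule sq.parity_kernel_free[OF subgroup_sanov_even sanov_even_free mult(1) wit(1)])
      (auto simp: p2_def dig)
  then have "sq_group\<lparr>carrier := {x \<in> K2. \<not> p3 x}\<rparr> \<cong> free_group {..<2 * (2 * 3 - 1) - 1 :: nat}"
    by (rule sq.parity_kernel_free[OF sub2 _ mult(2), of _ "(1, 0, 2, 2)"])
      (use wit in \<open>auto simp: K2_def p2_def p3_def dig\<close>)
  moreover have "{x \<in> K2. \<not> p3 x} = cong_quads 4"
  proof (intro subset_antisym subsetI)
    fix x assume x: "x \<in> {x \<in> K2. \<not> p3 x}"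
    obtain a b c d where x_eq: "x = (a, b, c, d)" by (cases x)
    obtain p q r s where pqrs: "digits 2 x = (p, q, r, s)" by (cases "digits 2 x")
    have x2: "x \<in> cong_quads 2" "x \<in> sanov" "\<not> q" "\<not> r"
      using x sanov_even_subset pqrs by (auto simp: K2_def sanov_even_def p2_def p3_def)
    then have "\<not> s" using digits_of_2[OF x2(1) pqrs] by simp
    have 2: "even b" "even c" "even d" "sq_norm (a, b, c, d) \<in> {1, -1}"
      using x2(1) unfolding x_eq cong_quads_iff by auto
    have "even (b div 2)" "even (c div 2)" "even (d div 2)"
      using pqrs x2(3,4) \<open>\<not> s\<close> by (auto simp: x_eq digits_def)
    then have "4 dvd b" "4 dvd c" "4 dvd d" using 2 by presburger+
    moreover have "4 dvd a + b - 1" using x2(2) unfolding x_eq sanov_iff by blast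
    then have "4 dvd a - 1" using \<open>4 dvd b\<close> by presburger
    ultimately show "x \<in> cong_quads 4" unfolding x_eq cong_quads_iff using 2(4) by blast
  next
    fix x assume x: "x \<in> cong_quads 4"
    obtain a b c d where x_eq: "x = (a, b, c, d)" by (cases x)
    have x4: "sq_norm (a, b, c, d) \<in> {1, -1}" "4 dvd a - 1" "4 dvd b" "4 dvd c" "4 dvd d"
      using x unfolding x_eq cong_quads_iff by blast+
    then have "4 dvd a + b - 1" "4 dvd a - b - 1" "even (c + d)" "even d" by presburger+
    then have "x \<in> sanov_even"
      using x4(1) by (simp add: x_eq sanov_even_def sanov_iff)
    moreover have "digits 2 x = (False, False, False, False)"
      using x cong_quads_double[of 2] by simp
    ultimately show "x \<in> {x \<in> K2. \<not> p3 x}"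
      by (simp add: K2_def p2_def p3_def)
  qed
  ultimately show ?thesis by simp
qed

lemma cong_quads_power_free:
  "sq_group\<lparr>carrier := cong_quads (2 ^ (k + 2))\<rparr> \<cong> free_group {..<1 + 8 ^ (k + 1) :: nat}"
proof (induction k)
  case 0
  then show ?case using cong_quads_4_free by simp
next
  case (Suc k)
  have "8 * (1 + 8 ^ (k + 1)) - 7 = (1 + 8 ^ (Suc k + 1) :: nat)" by simp
  then show ?case
    using cong_quads_double_free[OF _ _ Suc] by (simp add: mult.assoc)
qed

section \<open>Splitting off -1 in U_1\<close>

text \<open>In \<open>cong_quads 2\<close> the number \<open>a + b\<close> is odd, so exactly one of
  x and -x has it equal to 1 modulo 4 and lies in \<open>sanov_even\<close>. As -1 is central, it
  splits off as a direct factor.\<close>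

lemma cong_quads_2_iso:
  "sq_group\<lparr>carrier := cong_quads 2\<rparr> \<cong> free_group {..<3::nat} \<times>\<times> integer_mod_group 2"
proof -
  define \<phi> :: "quad \<times> int \<Rightarrow> quad" where
    "\<phi> = (\<lambda>((a, b, c, d), e). if e = 0 then (a, b, c, d) else (- a, - b, - c, - d))"
  interpret E: group "sq_group\<lparr>carrier := sanov_even\<rparr>"
    by (rule sq.subgroup_imp_group[OF subgroup_sanov_even])
  have mod2: "carrier (integer_mod_group 2) = {0, 1}"
    by (auto simp: carrier_integer_mod_group)
  have "\<phi> \<in> iso (sq_group\<lparr>carrier := sanov_even\<rparr> \<times>\<times> integer_mod_group 2) (sq_group\<lparr>carrier := cong_quads 2\<rparr>)"
  proof (rule isoI)
    show "\<phi> \<in> hom (sq_group\<lparr>carrier := sanov_even\<rparr> \<times>\<times> integer_mod_group 2) (sq_group\<lparr>carrier := cong_quads 2\<rparr>)"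
    proof (rule homI)
      fix x assume "x \<in> carrier (sq_group\<lparr>carrier := sanov_even\<rparr> \<times>\<times> integer_mod_group 2)"
      then obtain a b c d e where x: "x = ((a, b, c, d), e)" "(a, b, c, d) \<in> sanov_even"
        by (auto simp: DirProd_def)
      then have "(a, b, c, d) \<in> cong_quads 2" using sanov_even_subset by blast
      then show "\<phi> x \<in> carrier (sq_group\<lparr>carrier := cong_quads 2\<rparr>)"
        by (simp add: x \<phi>_def cong_quads_iff)
    next
      fix x y assume "x \<in> carrier (sq_group\<lparr>carrier := sanov_even\<rparr> \<times>\<times> integer_mod_group 2)"
        "y \<in> carrier (sq_group\<lparr>carrier := sanov_even\<rparr> \<times>\<times> integer_mod_group 2)"
      then obtain a b c d e a' b' c' d' e' where
        x: "x = ((a, b, c, d), e)" "e \<in> {0, 1}" and y: "y = ((a', b', c', d'), e')" "e' \<in> {0, 1}"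
        by (auto simp: DirProd_def mod2)
      show "\<phi> (x \<otimes>\<^bsub>sq_group\<lparr>carrier := sanov_even\<rparr> \<times>\<times> integer_mod_group 2\<^esub> y)
          = \<phi> x \<otimes>\<^bsub>sq_group\<lparr>carrier := cong_quads 2\<rparr>\<^esub> \<phi> y"
        using x y by (auto simp: \<phi>_def DirProd_def)
    qed
    \<comment> \<open>For even \<open>b\<close> the two diagonal conditions modulo 4 are
      equivalent.\<close>
    have pos: "(a, b, c, d) \<in> sanov_even \<longleftrightarrow> sq_norm (a, b, c, d) \<in> {1, -1} \<and>
        4 dvd a + b - 1 \<and> even b \<and> even c \<and> even d" for a b c d
    proof -
      have "4 dvd a + b - 1 \<and> 4 dvd a - b - 1 \<and> even (c + d) \<and> even d
          \<longleftrightarrow> 4 dvd a + b - 1 \<and> even b \<and> even c \<and> even d" by presburger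
      then show ?thesis by (auto simp: sanov_even_def sanov_iff simp del: sq_norm_simp)
    qed
    have "inj_on \<phi> (sanov_even \<times> {0, 1})"
    proof (rule inj_onI)
      fix x y assume xy: "x \<in> sanov_even \<times> {0, 1}" "y \<in> sanov_even \<times> {0, 1}" "\<phi> x = \<phi> y"
      obtain a b c d e where x: "x = ((a, b, c, d), e)" by (metis prod.collapse)
      obtain a' b' c' d' e' where y: "y = ((a', b', c', d'), e')" by (metis prod.collapse)
      have "4 dvd a + b - 1" "4 dvd a' + b' - 1"
        using xy unfolding x y by (auto simp: pos)
      \<comment> \<open>Opposite quadruples would make \<open>a + b\<close> both 1 and -1 modulo 4,
        so the flags must agree.\<close>
      then have "\<not> (a = - a' \<and> b = - b')" by presburger
      then show "x = y" using xy unfolding x y by (auto simp: \<phi>_def split: if_splits)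
    qed
    moreover have "\<phi> ` (sanov_even \<times> {0, 1}) = cong_quads 2"
    proof (intro subset_antisym subsetI)
      fix x assume "x \<in> \<phi> ` (sanov_even \<times> {0, 1})"
      then obtain a b c d where "(a, b, c, d) \<in> cong_quads 2" "x = (a, b, c, d) \<or> x = (- a, - b, - c, - d)"
        using sanov_even_subset by (auto simp: \<phi>_def)
      then show "x \<in> cong_quads 2" by (auto simp: cong_quads_iff)
    next
      fix x assume x: "x \<in> cong_quads 2"
      obtain a b c d where x_eq: "x = (a, b, c, d)" by (cases x)
      have x2: "sq_norm (a, b, c, d) \<in> {1, -1}" "2 dvd a - 1" "even b" "even c" "even d"
        using x unfolding x_eq cong_quads_iff by blast+
      have "4 dvd a + b - 1 \<or> 4 dvd - a + - b - 1" using x2 by presburger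
      then have "(a, b, c, d) \<in> sanov_even \<or> (- a, - b, - c, - d) \<in> sanov_even"
        using x2 by (simp add: pos)
      then have "((a, b, c, d), 0) \<in> sanov_even \<times> {0, 1::int} \<and> x = \<phi> ((a, b, c, d), 0)
        \<or> ((- a, - b, - c, - d), 1) \<in> sanov_even \<times> {0, 1::int} \<and> x = \<phi> ((- a, - b, - c, - d), 1)"
        by (simp add: x_eq \<phi>_def)
      then show "x \<in> \<phi> ` (sanov_even \<times> {0, 1})" by blast
    qed
    ultimately show "bij_betw \<phi> (carrier (sq_group\<lparr>carrier := sanov_even\<rparr> \<times>\<times> integer_mod_group 2))
        (carrier (sq_group\<lparr>carrier := cong_quads 2\<rparr>))"
      by (simp add: bij_betw_def DirProd_def mod2)
  qed
  then have "sq_group\<lparr>carrier := sanov_even\<rparr> \<times>\<times> integer_mod_group 2 \<cong> sq_group\<lparr>carrier := cong_quads 2\<rparr>"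
    by (auto simp: is_iso_def)
  then have "sq_group\<lparr>carrier := cong_quads 2\<rparr> \<cong> sq_group\<lparr>carrier := sanov_even\<rparr> \<times>\<times> integer_mod_group 2"
    by (rule group.iso_sym[OF DirProd_group[OF E.group_axioms group_integer_mod_group]])
  moreover have "sq_group\<lparr>carrier := sanov_even\<rparr> \<times>\<times> integer_mod_group 2
      \<cong> free_group {..<3::nat} \<times>\<times> integer_mod_group 2"
    by (rule E.DirProd_iso_trans[OF sanov_even_free]) (rule iso_refl)
  ultimately show ?thesis by (rule iso_trans)
qed

section \<open>The twisted group ring of the Klein four-group\<close>

text \<open>The hypotheses of the theorem in terms of the cocycle: relations between u_g and u_h
  become values of \<open>\<alpha>\<close>, the commutator relation becoming
  \<open>\<alpha>_anti\<close>.\<close>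

locale split_klein_ring = comm_group G for G (structure) +
  fixes g h and \<alpha> :: "'a \<Rightarrow> 'a \<Rightarrow> int"
  assumes carrier_eq: "carrier G = {\<one>, g, h, g \<otimes> h}"
    and distinct: "distinct [\<one>, g, h, g \<otimes> h]"
    and squares: "g \<otimes> g = \<one>" "h \<otimes> h = \<one>"
    and cocycle: "normalized_sign_cocycle G \<alpha>"
    and \<alpha>_squares: "\<alpha> g g = 1" "\<alpha> h h = 1"
    and \<alpha>_anti: "\<alpha> h g = - \<alpha> g h"
begin

abbreviation R where "R \<equiv> twisted_group_ring G \<alpha>"

section \<open>Multiplication tables of the group and of the cocycle\<close>

lemma gh_carrier [simp]: "g \<in> carrier G" "h \<in> carrier G" "g \<otimes> h \<in> carrier G"
  using carrier_eq by blast+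

lemma carrier_cases:
  assumes "x \<in> carrier G"
  obtains "x = \<one>" | "x = g" | "x = h" | "x = g \<otimes> h"
  using assms carrier_eq by blast

lemma finite_carrier: "finite (carrier G)"
  unfolding carrier_eq by blast

lemma group_table [simp]:
  "g \<otimes> g = \<one>" "h \<otimes> h = \<one>" "h \<otimes> g = g \<otimes> h" "g \<otimes> (g \<otimes> h) = h" "h \<otimes> (g \<otimes> h) = g"
  "g \<otimes> h \<otimes> g = h" "g \<otimes> h \<otimes> h = g" "g \<otimes> h \<otimes> (g \<otimes> h) = \<one>"
proof -
  show hg: "h \<otimes> g = g \<otimes> h" by (rule m_comm) simp_all
  show ggh: "g \<otimes> (g \<otimes> h) = h" by (simp add: m_assoc[symmetric] squares)
  show hgh: "h \<otimes> (g \<otimes> h) = g"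
    by (subst hg[symmetric]) (simp add: m_assoc[symmetric] squares)
  show "g \<otimes> h \<otimes> g = h" using ggh by (simp add: m_assoc hg)
  show ghh: "g \<otimes> h \<otimes> h = g" by (simp add: m_assoc squares)
  show "g \<otimes> h \<otimes> (g \<otimes> h) = \<one>" using hgh by (simp add: m_assoc squares)
qed (rule squares)+

lemma gh_distinct [simp]:
  "g \<noteq> \<one>" "h \<noteq> \<one>" "g \<otimes> h \<noteq> \<one>" "g \<noteq> h" "g \<noteq> g \<otimes> h" "h \<noteq> g \<otimes> h"
  "\<one> \<noteq> g" "\<one> \<noteq> h" "\<one> \<noteq> g \<otimes> h" "h \<noteq> g" "g \<otimes> h \<noteq> g" "g \<otimes> h \<noteq> h"
  using distinct by auto

text \<open>The relations leave this sign open: u_g u_h = \<epsilon> u_gh.\<close>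

definition \<epsilon> :: int where "\<epsilon> = \<alpha> g h"

lemma \<epsilon>: "\<epsilon> = 1 \<or> \<epsilon> = -1"
  using cocycle gh_carrier(1,2) unfolding normalized_sign_cocycle_def \<epsilon>_def by blast

lemma sum_carrier: "(\<Sum>x\<in>carrier G. f x :: int) = f \<one> + f g + f h + f (g \<otimes> h)"
  unfolding carrier_eq by (simp add: add.assoc)

text \<open>Each remaining value follows from the cocycle identity at a triple whose products
  collapse by \<open>group_table\<close>.\<close>

lemma \<alpha>_table:
  "x \<in> carrier G \<Longrightarrow> \<alpha> \<one> x = 1" "x \<in> carrier G \<Longrightarrow> \<alpha> x \<one> = 1"
  "\<alpha> g g = 1" "\<alpha> h h = 1" "\<alpha> g h = \<epsilon>" "\<alpha> h g = - \<epsilon>"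
  "\<alpha> g (g \<otimes> h) = \<epsilon>" "\<alpha> (g \<otimes> h) h = \<epsilon>" "\<alpha> h (g \<otimes> h) = - \<epsilon>" "\<alpha> (g \<otimes> h) g = - \<epsilon>"
  "\<alpha> (g \<otimes> h) (g \<otimes> h) = -1"
proof -
  have coc: "\<alpha> x y * \<alpha> (x \<otimes> y) z = \<alpha> y z * \<alpha> x (y \<otimes> z)"
    if "x \<in> carrier G" "y \<in> carrier G" "z \<in> carrier G" for x y z
    using cocycle that unfolding normalized_sign_cocycle_def by blast
  show one: "\<alpha> \<one> x = 1" "\<alpha> x \<one> = 1" if "x \<in> carrier G" for x
    using cocycle that unfolding normalized_sign_cocycle_def by blast+
  show gh: "\<alpha> g h = \<epsilon>" "\<alpha> h g = - \<epsilon>" by (simp_all add: \<epsilon>_def \<alpha>_anti)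
  show "\<alpha> g (g \<otimes> h) = \<epsilon>" using coc[of g g h] \<epsilon> by (auto simp: gh \<alpha>_squares one)
  show "\<alpha> (g \<otimes> h) h = \<epsilon>" using coc[of g h h] \<epsilon> by (auto simp: gh \<alpha>_squares one)
  show hgh: "\<alpha> h (g \<otimes> h) = - \<epsilon>" using coc[of h h g] \<epsilon> by (auto simp: gh \<alpha>_squares one)
  show "\<alpha> (g \<otimes> h) g = - \<epsilon>" using coc[of h g g] \<epsilon> by (auto simp: gh \<alpha>_squares one)
  show "\<alpha> (g \<otimes> h) (g \<otimes> h) = -1"
    using coc[of g h "g \<otimes> h"] \<epsilon> by (auto simp: gh hgh \<alpha>_squares one)
qed (rule \<alpha>_squares)+

lemma carrier_R: "f \<in> carrier R \<longleftrightarrow> (\<forall>x. x \<notin> carrier G \<longrightarrow> f x = 0)"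
proof -
  have "finite {x. f x \<noteq> 0}" if "{x. f x \<noteq> 0} \<subseteq> carrier G"
    using that finite_carrier finite_subset by blast
  then show ?thesis by (auto simp: twisted_group_ring_def)
qed

text \<open>Extending the sums over supports by zero terms to all of \<open>G\<close> makes products
  expandable with \<open>sum_carrier\<close>.\<close>

lemma R_mult:
  assumes "f \<in> carrier R" "f' \<in> carrier R"
  shows "(f \<otimes>\<^bsub>R\<^esub> f') z =
    (\<Sum>x\<in>carrier G. \<Sum>y\<in>carrier G. if x \<otimes> y = z then f x * f' y * \<alpha> x y else 0)"
proof -
  have "(\<Sum>y | f' y \<noteq> 0 \<and> x \<otimes> y = z. f x * f' y * \<alpha> x y)
      = (\<Sum>y\<in>carrier G. if x \<otimes> y = z then f x * f' y * \<alpha> x y else 0)" for x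
    using assms(2) finite_carrier by (intro sum.mono_neutral_cong_left) (auto simp: carrier_R)
  then have "(f \<otimes>\<^bsub>R\<^esub> f') z = (\<Sum>x | f x \<noteq> 0.
      \<Sum>y\<in>carrier G. if x \<otimes> y = z then f x * f' y * \<alpha> x y else 0)"
    by (simp add: twisted_group_ring_def)
  also have "\<dots> = (\<Sum>x\<in>carrier G. \<Sum>y\<in>carrier G. if x \<otimes> y = z then f x * f' y * \<alpha> x y else 0)"
    using assms(1) finite_carrier by (intro sum.mono_neutral_cong_left) (auto simp: carrier_R intro!: sum.neutral)
  finally show ?thesis .
qed

lemma R_mult_closed: "f \<in> carrier R \<Longrightarrow> f' \<in> carrier R \<Longrightarrow> f \<otimes>\<^bsub>R\<^esub> f' \<in> carrier R"
  unfolding carrier_R[of "f \<otimes>\<^bsub>R\<^esub> f'"] by (auto simp: R_mult intro!: sum.neutral)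

section \<open>Coordinates identifying the ring with the quaternion order\<close>

text \<open>The factor \<open>\<epsilon>\<close> turns the coefficient of u_gh into that of k = u_g
  u_h, so the open sign drops out of the multiplication rule.\<close>

definition coeffs :: "('a \<Rightarrow> int) \<Rightarrow> quad" where
  "coeffs f = (f \<one>, f g, f h, \<epsilon> * f (g \<otimes> h))"

definition of_coeffs :: "quad \<Rightarrow> 'a \<Rightarrow> int" where
  "of_coeffs = (\<lambda>(a, b, c, d) z. if z = \<one> then a else if z = g then b else if z = h then c
     else if z = g \<otimes> h then \<epsilon> * d else 0)"

lemma of_coeffs_closed: "of_coeffs x \<in> carrier R"
  by (cases x) (auto simp: carrier_R of_coeffs_def)

lemma coeffs_of_coeffs: "coeffs (of_coeffs x) = x"
  using \<epsilon> by (cases x) (auto simp: coeffs_def of_coeffs_def)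

lemma of_coeffs_coeffs:
  assumes "f \<in> carrier R"
  shows "of_coeffs (coeffs f) = f"
proof
  show "of_coeffs (coeffs f) z = f z" for z
  proof (cases "z \<in> carrier G")
    case True
    then show ?thesis by (rule carrier_cases) (use \<epsilon> in \<open>auto simp: coeffs_def of_coeffs_def\<close>)
  next
    case False
    then show ?thesis using assms by (auto simp: coeffs_def of_coeffs_def carrier_R)
  qed
qed

lemma coeffs_inj: "f \<in> carrier R \<Longrightarrow> f' \<in> carrier R \<Longrightarrow> coeffs f = coeffs f' \<Longrightarrow> f = f'"
  by (metis of_coeffs_coeffs)

lemma coeffs_one: "coeffs \<one>\<^bsub>R\<^esub> = (1, 0, 0, 0)"
  by (simp add: coeffs_def twisted_group_ring_def twisted_basis_def)

lemma one_closed_R: "\<one>\<^bsub>R\<^esub> \<in> carrier R"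
  by (auto simp: carrier_R) (simp add: twisted_group_ring_def twisted_basis_def, auto)

lemma coeffs_mult:
  assumes "f \<in> carrier R" "f' \<in> carrier R"
  shows "coeffs (f \<otimes>\<^bsub>R\<^esub> f') = coeffs f \<otimes>\<^bsub>sq_group\<^esub> coeffs f'"
  using \<epsilon> by (auto simp: coeffs_def R_mult[OF assms] sum_carrier \<alpha>_table algebra_simps)

text \<open>The axioms are pulled back from quadruples along the injective map
  \<open>coeffs\<close>.\<close>

lemma monoid_R: "monoid R"
proof (rule monoidI)
  fix x y z assume "x \<in> carrier R" "y \<in> carrier R" "z \<in> carrier R"
  then show "x \<otimes>\<^bsub>R\<^esub> y \<otimes>\<^bsub>R\<^esub> z = x \<otimes>\<^bsub>R\<^esub> (y \<otimes>\<^bsub>R\<^esub> z)"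
    by (intro coeffs_inj) (simp_all add: coeffs_mult R_mult_closed sq_assoc)
next
  fix x assume x: "x \<in> carrier R"
  then show "\<one>\<^bsub>R\<^esub> \<otimes>\<^bsub>R\<^esub> x = x"
    by (intro coeffs_inj) (simp_all add: coeffs_mult R_mult_closed one_closed_R coeffs_one, cases "coeffs x", simp)
  show "x \<otimes>\<^bsub>R\<^esub> \<one>\<^bsub>R\<^esub> = x"
    using x by (intro coeffs_inj) (simp_all add: coeffs_mult R_mult_closed one_closed_R coeffs_one, cases "coeffs x", simp)
qed (simp_all add: R_mult_closed one_closed_R)

text \<open>The norm is multiplicative, so that of a unit divides 1. Conversely the inverse in
  \<open>sq_group\<close> pulls back to a two-sided inverse.\<close>

lemma Units_R: "f \<in> Units R \<longleftrightarrow> f \<in> carrier R \<and> coeffs f \<in> carrier sq_group"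
proof
  assume "f \<in> Units R"
  then obtain y where y: "f \<in> carrier R" "y \<in> carrier R" "y \<otimes>\<^bsub>R\<^esub> f = \<one>\<^bsub>R\<^esub>"
    by (auto simp: Units_def)
  then have "coeffs y \<otimes>\<^bsub>sq_group\<^esub> coeffs f = (1, 0, 0, 0)"
    using coeffs_mult[of y f] coeffs_one by simp
  then have "sq_norm (coeffs y) * sq_norm (coeffs f) = 1" by (simp add: sq_norm_mult[symmetric])
  then show "f \<in> carrier R \<and> coeffs f \<in> carrier sq_group"
    using y(1) by (auto simp: zmult_eq_1_iff)
next
  assume f: "f \<in> carrier R \<and> coeffs f \<in> carrier sq_group"
  define y where "y = of_coeffs (inv\<^bsub>sq_group\<^esub> coeffs f)"
  have y: "y \<in> carrier R" "coeffs y = inv\<^bsub>sq_group\<^esub> coeffs f"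
    by (simp_all only: y_def of_coeffs_closed coeffs_of_coeffs)
  have "coeffs (y \<otimes>\<^bsub>R\<^esub> f) = \<one>\<^bsub>sq_group\<^esub>" "coeffs (f \<otimes>\<^bsub>R\<^esub> y) = \<one>\<^bsub>sq_group\<^esub>"
    using f y(1) by (simp_all only: coeffs_mult y(2) sq.l_inv sq.r_inv)
  then have "y \<otimes>\<^bsub>R\<^esub> f = \<one>\<^bsub>R\<^esub>" "f \<otimes>\<^bsub>R\<^esub> y = \<one>\<^bsub>R\<^esub>"
    using f y(1) by (auto intro!: coeffs_inj simp: R_mult_closed one_closed_R coeffs_one)
  then show "f \<in> Units R" using f y(1) by (auto simp: Units_def)
qed

lemma group_units_R: "group (units_of R)"
  by (rule monoid.units_group[OF monoid_R])

lemma coeffs_iso: "coeffs \<in> iso (units_of R) sq_group"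
proof (rule isoI)
  show "coeffs \<in> hom (units_of R) sq_group"
    by (rule homI) (auto simp: units_of_carrier units_of_mult Units_R coeffs_mult simp del: sq_group_simps(1))
  show "bij_betw coeffs (carrier (units_of R)) (carrier sq_group)"
    by (rule bij_betwI[where g = of_coeffs])
      (auto simp: units_of_carrier Units_R of_coeffs_closed coeffs_of_coeffs of_coeffs_coeffs simp del: sq_group_simps(1))
qed

section \<open>Transfer of the congruence subgroups to the unit group\<close>

lemma add_pow_R: "add_pow R (n::nat) u = (\<lambda>z. int n * u z)"
  by (induction n) (simp_all add: add_pow_def nat_pow_def twisted_group_ring_def algebra_simps)

lemma congruence_units_iff:
  "f \<in> congruence_units R i \<longleftrightarrow> f \<in> Units R \<and> coeffs f \<in> cong_quads (2 ^ i)"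
proof
  assume f: "f \<in> congruence_units R i"
  then obtain u where u: "f = \<one>\<^bsub>R\<^esub> \<oplus>\<^bsub>R\<^esub> add_pow R (2 ^ i :: nat) u"
    by (auto simp: congruence_units_def)
  have "coeffs f = (1 + 2 ^ i * u \<one>, 2 ^ i * u g, 2 ^ i * u h, 2 ^ i * (\<epsilon> * u (g \<otimes> h)))"
    unfolding u add_pow_R
    by (simp add: coeffs_def twisted_group_ring_def twisted_basis_def)
  moreover have "f \<in> Units R" using f by (simp add: congruence_units_def)
  ultimately show "f \<in> Units R \<and> coeffs f \<in> cong_quads (2 ^ i)"
    using Units_R[of f] by (simp add: cong_quads_iff del: sq_norm_simp)
next
  assume f: "f \<in> Units R \<and> coeffs f \<in> cong_quads (2 ^ i)"
  then obtain a b c d where abcd: "coeffs f = (1 + 2 ^ i * a, 2 ^ i * b, 2 ^ i * c, 2 ^ i * d)"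
    by (auto elim: cong_quadsE)
  define u where "u = of_coeffs (a, b, c, d)"
  have u: "u \<in> carrier R" "coeffs u = (a, b, c, d)"
    by (simp_all only: u_def of_coeffs_closed coeffs_of_coeffs)
  have "f = \<one>\<^bsub>R\<^esub> \<oplus>\<^bsub>R\<^esub> add_pow R (2 ^ i :: nat) u"
  proof (rule coeffs_inj)
    show "f \<in> carrier R" using f Units_R by blast
    show "\<one>\<^bsub>R\<^esub> \<oplus>\<^bsub>R\<^esub> add_pow R (2 ^ i :: nat) u \<in> carrier R"
      using u(1) unfolding add_pow_R carrier_R
      by (auto simp: twisted_group_ring_def twisted_basis_def)
    show "coeffs f = coeffs (\<one>\<^bsub>R\<^esub> \<oplus>\<^bsub>R\<^esub> add_pow R (2 ^ i :: nat) u)"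
      using u(2) unfolding add_pow_R abcd
      by (auto simp: coeffs_def twisted_group_ring_def twisted_basis_def algebra_simps)
  qed
  then show "f \<in> congruence_units R i"
    using f u(1) by (auto simp: congruence_units_def)
qed

lemma coeffs_image_units: "coeffs ` carrier (units_of R) = {x. sq_norm x \<in> {1, -1}}"
  using coeffs_iso by (auto simp: iso_def bij_betw_def)

lemma coeffs_image_congruence_units:
  "coeffs ` congruence_units R i = cong_quads (2 ^ i)"
proof (intro subset_antisym subsetI)
  fix x assume x: "x \<in> cong_quads (2 ^ i)"
  then have "x \<in> carrier sq_group" by (auto simp: cong_quads_def)
  then have "of_coeffs x \<in> congruence_units R i"
    using x unfolding congruence_units_iff Units_R coeffs_of_coeffs by (simp add: of_coeffs_closed)
  then show "x \<in> coeffs ` congruence_units R i"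
    using coeffs_of_coeffs[of x] by (metis imageI)
qed (auto simp: congruence_units_iff)

interpretation units: group "units_of R" by (rule group_units_R)

interpretation coeffs: group_hom "units_of R" sq_group coeffs
  using coeffs_iso by unfold_locales (simp add: iso_def)

lemma subgroup_congruence_units:
  assumes "i \<ge> 1"
  shows "subgroup (congruence_units R i) (units_of R)"
proof -
  interpret C: subgroup "cong_quads (2 ^ i)" sq_group
    using assms by (intro subgroup_cong_quads) simp
  have eq: "congruence_units R i = {f \<in> carrier (units_of R). coeffs f \<in> cong_quads (2 ^ i)}"
    by (auto simp: congruence_units_iff units_of_carrier)
  show ?thesis
    unfolding eq
  proof (rule units.subgroupI)
    have "coeffs \<one>\<^bsub>units_of R\<^esub> \<in> cong_quads (2 ^ i)"
      using C.one_closed by (simp only: coeffs.hom_one)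
    then show "{f \<in> carrier (units_of R). coeffs f \<in> cong_quads (2 ^ i)} \<noteq> {}"
      using units.one_closed by blast
  qed (use C.m_closed C.m_inv_closed in \<open>auto simp del: sq_group_simps\<close>)
qed

lemma congruence_units_iso:
  "(units_of R)\<lparr>carrier := congruence_units R i\<rparr> \<cong> sq_group\<lparr>carrier := cong_quads (2 ^ i)\<rparr>"
proof -
  have "congruence_units R i \<subseteq> carrier (units_of R)"
    by (auto simp: congruence_units_iff units_of_carrier)
  then show ?thesis
    using iso_restrict_carrier[OF coeffs_iso _ coeffs_image_congruence_units] by (auto simp: is_iso_def)
qed

lemma card_rcosets_congruence_units_1:
  "card (rcosets\<^bsub>units_of R\<^esub> (congruence_units R 1)) = 8"
proof -
  have "card (rcosets\<^bsub>units_of R\<^esub> (congruence_units R 1)) = card ((par4 \<circ> coeffs) ` carrier (units_of R))"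
  proof (rule units.card_rcosets_eq_card_image[OF subgroup_congruence_units])
    fix x y assume xy: "x \<in> carrier (units_of R)" "y \<in> carrier (units_of R)"
    then have "sq_norm (coeffs x) \<in> {1, -1}" "sq_norm (coeffs y) \<in> {1, -1}"
      using coeffs_image_units by blast+
    moreover have "x \<otimes>\<^bsub>units_of R\<^esub> inv\<^bsub>units_of R\<^esub> y \<in> Units R"
      using xy units.m_closed units.inv_closed by (metis units_of_carrier)
    ultimately show "((par4 \<circ> coeffs) x = (par4 \<circ> coeffs) y)
        = (x \<otimes>\<^bsub>units_of R\<^esub> inv\<^bsub>units_of R\<^esub> y \<in> congruence_units R 1)"
      using xy by (simp add: par4_eq_iff congruence_units_iff del: sq_group_simps)
  qed simp
  then show ?thesis
    by (simp only: image_comp[symmetric] coeffs_image_units card_par4_image)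
qed

lemma congruence_units_Suc_subset: "congruence_units R (i + 1) \<subseteq> congruence_units R i"
  using cong_quads_double[of "2 ^ i"] by (auto simp: congruence_units_iff)

lemma card_rcosets_congruence_units_Suc:
  assumes "i \<ge> 1"
  shows "card (rcosets\<^bsub>(units_of R)\<lparr>carrier := congruence_units R i\<rparr>\<^esub> (congruence_units R (i + 1))) = 8"
proof -
  let ?U = "(units_of R)\<lparr>carrier := congruence_units R i\<rparr>"
  have sub: "subgroup (congruence_units R i) (units_of R)"
    by (rule subgroup_congruence_units[OF assms])
  interpret U: group ?U by (rule units.subgroup_imp_group[OF sub])
  have "card (rcosets\<^bsub>?U\<^esub> (congruence_units R (i + 1))) = card ((digits (2 ^ i) \<circ> coeffs) ` carrier ?U)"
  proof (rule U.card_rcosets_eq_card_image)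
    show "subgroup (congruence_units R (i + 1)) ?U"
      using units.subgroup_incl[OF subgroup_congruence_units sub congruence_units_Suc_subset] by simp
    fix x y assume "x \<in> carrier ?U" "y \<in> carrier ?U"
    then have xy: "x \<in> congruence_units R i" "y \<in> congruence_units R i" by simp_all
    then have xy': "x \<in> carrier (units_of R)" "y \<in> carrier (units_of R)"
      "coeffs x \<in> cong_quads (2 ^ i)" "coeffs y \<in> cong_quads (2 ^ i)"
      by (simp_all add: congruence_units_iff units_of_carrier)
    have "x \<otimes>\<^bsub>units_of R\<^esub> inv\<^bsub>units_of R\<^esub> y \<in> Units R"
      using xy' units.m_closed units.inv_closed by (metis units_of_carrier)
    then have "(x \<otimes>\<^bsub>units_of R\<^esub> inv\<^bsub>units_of R\<^esub> y \<in> congruence_units R (i + 1))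
        = (coeffs x \<otimes>\<^bsub>sq_group\<^esub> inv\<^bsub>sq_group\<^esub> coeffs y \<in> cong_quads (2 * 2 ^ i))"
      using xy' by (simp add: congruence_units_iff del: sq_group_simps)
    then show "((digits (2 ^ i) \<circ> coeffs) x = (digits (2 ^ i) \<circ> coeffs) y)
        = (x \<otimes>\<^bsub>?U\<^esub> inv\<^bsub>?U\<^esub> y \<in> congruence_units R (i + 1))"
      using digits_eq_iff[OF xy'(3,4)] assms units.m_inv_consistent[OF sub xy(2)] by simp
  qed
  also have "\<dots> = card (digits (2 ^ i) ` cong_quads (2 ^ i))"
    unfolding image_comp[symmetric] by (simp add: coeffs_image_congruence_units)
  also have "\<dots> = 8"
  proof (rule card_digits_image)
    \<comment> \<open>Residues obey different constraints for \<open>i = 1\<close> and for larger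
      \<open>i\<close>, but eight of them remain in both cases.\<close>
    show "(2 ^ i :: int) = 2 \<or> (4 :: int) dvd 2 ^ i"
    proof (cases "i = 1")
      case False
      then obtain k where "i = k + 2" using assms by (metis One_nat_def Suc_1 add.commute le_Suc_ex not_less_eq_eq le_antisym)
      then show ?thesis by simp
    qed simp
  qed simp
  finally show ?thesis .
qed

lemma congruence_units_1_free:
  "(units_of R)\<lparr>carrier := congruence_units R 1\<rparr> \<cong> free_group {..<3::nat} \<times>\<times> integer_mod_group 2"
  using iso_trans[OF congruence_units_iso[of 1]] cong_quads_2_iso by simp

lemma congruence_units_free:
  assumes "i \<ge> 2"
  shows "(units_of R)\<lparr>carrier := congruence_units R i\<rparr> \<cong> free_group {..<1 + 8 ^ (i - 1) :: nat}"
proof -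
  obtain k where "i = k + 2" using assms by (metis add.commute le_Suc_ex)
  then show ?thesis using iso_trans[OF congruence_units_iso cong_quads_power_free[of k]] by simp
qed

end

section \<open>From the hypotheses of the theorem to the locale\<close>

text \<open>Partial products in the commutator are signed basis elements; this evaluates the next
  factor.\<close>

lemma scaled_basis_mult:
  "(\<lambda>z. c * twisted_basis x z) \<otimes>\<^bsub>twisted_group_ring G \<alpha>\<^esub> twisted_basis y
     = (\<lambda>z. c * \<alpha> x y * twisted_basis (x \<otimes>\<^bsub>G\<^esub> y) z)"
proof
  fix z
  have 1: "{w. c * twisted_basis x w \<noteq> 0} = (if c = 0 then {} else {x})"
    by (auto simp: twisted_basis_def)
  have 2: "{w. twisted_basis y w \<noteq> 0 \<and> x \<otimes>\<^bsub>G\<^esub> w = z} = (if x \<otimes>\<^bsub>G\<^esub> y = z then {y} else {})"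
    by (auto simp: twisted_basis_def)
  show "((\<lambda>z. c * twisted_basis x z) \<otimes>\<^bsub>twisted_group_ring G \<alpha>\<^esub> twisted_basis y) z
          = c * \<alpha> x y * twisted_basis (x \<otimes>\<^bsub>G\<^esub> y) z"
    unfolding twisted_group_ring_def monoid.simps 1
    by (simp add: 2) (auto simp: twisted_basis_def)
qed

text \<open>The inverse is a definite description, and the ring is not yet known to be a monoid
  here. Uniqueness is direct: left multiplication by u_x permutes coefficients up to sign, so it is
  injective.\<close>

lemma inv_twisted_basis_involution:
  assumes "group G" "normalized_sign_cocycle G \<alpha>" "x \<in> carrier G"
    and inv: "twisted_basis x \<otimes>\<^bsub>twisted_group_ring G \<alpha>\<^esub> twisted_basis x = \<one>\<^bsub>twisted_group_ring G \<alpha>\<^esub>"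
    and xx: "x \<otimes>\<^bsub>G\<^esub> x = \<one>\<^bsub>G\<^esub>"
  shows "inv\<^bsub>twisted_group_ring G \<alpha>\<^esub> twisted_basis x = twisted_basis x"
  unfolding m_inv_def
proof (rule the_equality)
  interpret group G by fact
  let ?R = "twisted_group_ring G \<alpha>"
  have tb: "twisted_basis x \<in> carrier ?R"
    using assms(3) by (auto simp: twisted_group_ring_def twisted_basis_def)
  then show "twisted_basis x \<in> carrier ?R \<and> twisted_basis x \<otimes>\<^bsub>?R\<^esub> twisted_basis x = \<one>\<^bsub>?R\<^esub> \<and>
      twisted_basis x \<otimes>\<^bsub>?R\<^esub> twisted_basis x = \<one>\<^bsub>?R\<^esub>"
    using inv by simp
  fix y assume y: "y \<in> carrier ?R \<and> twisted_basis x \<otimes>\<^bsub>?R\<^esub> y = \<one>\<^bsub>?R\<^esub> \<and> y \<otimes>\<^bsub>?R\<^esub> twisted_basis x = \<one>\<^bsub>?R\<^esub>"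
  \<comment> \<open>Left translation by \<open>x\<close> is injective on \<open>G\<close>, so this
    coefficient comes from \<open>w\<close> alone.\<close>
  have left_mult: "(twisted_basis x \<otimes>\<^bsub>?R\<^esub> f) (x \<otimes>\<^bsub>G\<^esub> w) = f w * \<alpha> x w"
    if "w \<in> carrier G" "f \<in> carrier ?R" for f w
  proof -
    have "{v. twisted_basis x v \<noteq> 0} = {x}" by (auto simp: twisted_basis_def)
    moreover have "{v. f v \<noteq> 0 \<and> x \<otimes>\<^bsub>G\<^esub> v = x \<otimes>\<^bsub>G\<^esub> w} = (if f w = 0 then {} else {w})"
      using that assms(3) by (auto simp: twisted_group_ring_def)
    ultimately show ?thesis
      by (simp add: twisted_group_ring_def twisted_basis_def)
  qed
  show "y = twisted_basis x"
  proof
    fix w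
    show "y w = twisted_basis x w"
    proof (cases "w \<in> carrier G")
      case True
      have "y w * \<alpha> x w = twisted_basis x w * \<alpha> x w"
        using left_mult[OF True, of y] left_mult[OF True tb] y inv by simp
      moreover have "\<alpha> x w \<noteq> 0"
        using assms(2,3) True by (fastforce simp: normalized_sign_cocycle_def)
      ultimately show ?thesis by simp
    next
      case False
      have outside: "f w = 0" if "f \<in> carrier ?R" for f
      proof -
        have "{x. f x \<noteq> 0} \<subseteq> carrier G" using that by (simp add: twisted_group_ring_def)
        then show ?thesis using False by blast
      qed
      show ?thesis using outside[of y] outside[OF tb] y by simp
    qed
  qed
qed

text \<open>The negative too is a definite description; comparing coefficients gives its uniqueness
  without ring axioms.\<close>

lemma uminus_one_twisted_group_ring:
  assumes "\<one>\<^bsub>G\<^esub> \<in> carrier G"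
  shows "\<ominus>\<^bsub>twisted_group_ring G \<alpha>\<^esub> \<one>\<^bsub>twisted_group_ring G \<alpha>\<^esub> = (\<lambda>z. - twisted_basis \<one>\<^bsub>G\<^esub> z)"
  unfolding a_inv_def m_inv_def
proof (rule the_equality, goal_cases)
  case 1
  have "{x. twisted_basis \<one>\<^bsub>G\<^esub> x \<noteq> 0} = {\<one>\<^bsub>G\<^esub>}" by (auto simp: twisted_basis_def)
  then show ?case using assms by (simp add: twisted_group_ring_def fun_eq_iff)
next
  case (2 y)
  then have "twisted_basis \<one>\<^bsub>G\<^esub> z + y z = 0" for z
    by (simp add: twisted_group_ring_def fun_eq_iff)
  then show ?case by (simp add: fun_eq_iff eq_neg_iff_add_eq_0 add.commute)
qed

lemma (in group) ord_2_generate: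
  assumes "x \<in> carrier G" "ord x = 2"
  shows "x \<otimes> x = \<one>" "x \<noteq> \<one>" "generate G {x} = {\<one>, x}"
proof -
  show xx: "x \<otimes> x = \<one>"
    using pow_ord_eq_1[OF assms(1)] assms by (simp add: numeral_2_eq_2)
  show "x \<noteq> \<one>" using assms(2) by auto
  have "inv x = x" using xx assms(1) by (simp add: inv_equality)
  then have "subgroup {\<one>, x} G" using assms(1) xx by (intro subgroupI) auto
  then have "generate G {x} \<subseteq> {\<one>, x}" by (intro generate_subgroup_incl) auto
  then show "generate G {x} = {\<one>, x}" by (auto intro: generate.intros)
qed

text \<open>The order and product conditions list four distinct elements. The commutator relation
  and a cocycle identity both contain \<open>\<alpha> (g \<otimes> h) g\<close>; comparing them
  gives \<open>\<alpha> h g = - \<alpha> g h\<close>.\<close>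

lemma split_klein_ringI:
  fixes G :: "('a, 'm) monoid_scheme" and \<alpha> :: "'a \<Rightarrow> 'a \<Rightarrow> int"
  defines "R \<equiv> twisted_group_ring G \<alpha>"
  assumes "comm_group G" and gh: "g \<in> carrier G" "h \<in> carrier G"
    and ord: "group.ord G g = 2" "group.ord G h = 2"
    and inter: "generate G {g} \<inter> generate G {h} = {\<one>\<^bsub>G\<^esub>}"
    and prod: "generate G {g} <#>\<^bsub>G\<^esub> generate G {h} = carrier G"
    and cocycle: "normalized_sign_cocycle G \<alpha>"
    and sq: "twisted_basis g \<otimes>\<^bsub>R\<^esub> twisted_basis g = \<one>\<^bsub>R\<^esub>"
      "twisted_basis h \<otimes>\<^bsub>R\<^esub> twisted_basis h = \<one>\<^bsub>R\<^esub>"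
    and comm: "inv\<^bsub>R\<^esub> (twisted_basis g) \<otimes>\<^bsub>R\<^esub> inv\<^bsub>R\<^esub> (twisted_basis h)
        \<otimes>\<^bsub>R\<^esub> twisted_basis g \<otimes>\<^bsub>R\<^esub> twisted_basis h = \<ominus>\<^bsub>R\<^esub> \<one>\<^bsub>R\<^esub>"
  shows "split_klein_ring G g h \<alpha>"
proof -
  interpret comm_group G by fact
  note g2 = ord_2_generate[OF gh(1) ord(1)] and h2 = ord_2_generate[OF gh(2) ord(2)]
  have carrier: "carrier G = {\<one>\<^bsub>G\<^esub>, g, h, g \<otimes>\<^bsub>G\<^esub> h}"
  proof -
    have "{\<one>\<^bsub>G\<^esub>, g} <#>\<^bsub>G\<^esub> {\<one>\<^bsub>G\<^esub>, h} = {\<one>\<^bsub>G\<^esub>, g, h, g \<otimes>\<^bsub>G\<^esub> h}"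
      using gh by (simp add: set_mult_def insert_commute)
    then show ?thesis using prod by (simp only: g2(3) h2(3))
  qed
  have "g \<noteq> h" using inter g2 h2 by auto
  have "g \<otimes>\<^bsub>G\<^esub> h \<noteq> \<one>\<^bsub>G\<^esub>"
    using \<open>g \<noteq> h\<close> h2(1) gh by (metis r_cancel)
  moreover have "g \<otimes>\<^bsub>G\<^esub> h \<noteq> g" "g \<otimes>\<^bsub>G\<^esub> h \<noteq> h"
    using g2(2) h2(2) gh by (metis r_cancel_one' l_cancel_one')+
  ultimately have distinct: "distinct [\<one>\<^bsub>G\<^esub>, g, h, g \<otimes>\<^bsub>G\<^esub> h]"
    using \<open>g \<noteq> h\<close> g2(2) h2(2) by auto
  have one_R: "\<one>\<^bsub>twisted_group_ring G \<alpha>\<^esub> = twisted_basis \<one>\<^bsub>G\<^esub>"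
    by (simp add: twisted_group_ring_def)
  have \<alpha>_sq: "\<alpha> g g = 1" "\<alpha> h h = 1"
    using fun_cong[OF sq(1), of "\<one>\<^bsub>G\<^esub>"] fun_cong[OF sq(2), of "\<one>\<^bsub>G\<^esub>"]
    unfolding R_def twisted_basis_mult one_R g2(1) h2(1) by (simp_all add: twisted_basis_def)
  have invs: "inv\<^bsub>R\<^esub> twisted_basis g = twisted_basis g" "inv\<^bsub>R\<^esub> twisted_basis h = twisted_basis h"
    using inv_twisted_basis_involution[OF group_axioms cocycle gh(1)] sq(1) g2(1)
      inv_twisted_basis_involution[OF group_axioms cocycle gh(2)] sq(2) h2(1)
    by (simp_all add: R_def)
  have ghg: "g \<otimes>\<^bsub>G\<^esub> h \<otimes>\<^bsub>G\<^esub> g = h"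
    using gh g2(1) by (simp add: m_assoc m_comm[of h g]) (simp add: m_assoc[symmetric])
  \<comment> \<open>Both basis elements are their own inverses, so the commutator is this fourfold
    product.\<close>
  have "(\<lambda>z. \<alpha> g h * \<alpha> (g \<otimes>\<^bsub>G\<^esub> h) g * \<alpha> h h * twisted_basis \<one>\<^bsub>G\<^esub> z)
      = twisted_basis g \<otimes>\<^bsub>R\<^esub> twisted_basis h \<otimes>\<^bsub>R\<^esub> twisted_basis g \<otimes>\<^bsub>R\<^esub> twisted_basis h"
    unfolding R_def twisted_basis_mult scaled_basis_mult ghg h2(1) by simp
  also have "\<dots> = (\<lambda>z. - twisted_basis \<one>\<^bsub>G\<^esub> z)"
    using comm[unfolded invs] uminus_one_twisted_group_ring[OF one_closed, of \<alpha>]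
    by (simp only: R_def)
  finally have "\<alpha> g h * \<alpha> (g \<otimes>\<^bsub>G\<^esub> h) g = -1"
    by (auto dest: fun_cong[of _ _ "\<one>\<^bsub>G\<^esub>"] simp: \<alpha>_sq twisted_basis_def)
  \<comment> \<open>The cocycle identity at \<open>h, g, g\<close> ties \<open>\<alpha> h g\<close>
    to the factor shared with the commutator.\<close>
  moreover have "\<alpha> h g * \<alpha> (h \<otimes>\<^bsub>G\<^esub> g) g = \<alpha> g g * \<alpha> h (g \<otimes>\<^bsub>G\<^esub> g)"
    using cocycle gh unfolding normalized_sign_cocycle_def by blast
  then have "\<alpha> h g * \<alpha> (g \<otimes>\<^bsub>G\<^esub> h) g = 1"
    using cocycle gh by (simp add: \<alpha>_sq g2(1) m_comm[of h g] normalized_sign_cocycle_def)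
  moreover have "\<alpha> g h = 1 \<or> \<alpha> g h = -1" "\<alpha> h g = 1 \<or> \<alpha> h g = -1"
    using cocycle gh unfolding normalized_sign_cocycle_def by blast+
  ultimately have "\<alpha> h g = - \<alpha> g h" by auto
  then show ?thesis
    using carrier distinct g2(1) h2(1) cocycle \<alpha>_sq by unfold_locales
qed

theorem proposition8p3:
  fixes G :: "('a, 'm) monoid_scheme"
    and g h :: 'a
    and \<alpha> :: "'a \<Rightarrow> 'a \<Rightarrow> int"
    and R :: "('a \<Rightarrow> int) ring"
    and U :: "nat \<Rightarrow> ('a \<Rightarrow> int) set"
  assumes "comm_group G"
    and "g \<in> carrier G" "h \<in> carrier G"
    and "group.ord G g = 2" "group.ord G h = 2"
    and "generate G {g} \<inter> generate G {h} = {\<one>\<^bsub>G\<^esub>}"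
    and "generate G {g} <#>\<^bsub>G\<^esub> generate G {h} = carrier G"
    and "normalized_sign_cocycle G \<alpha>"
    and R_eq: "R = twisted_group_ring G \<alpha>"
    and "twisted_basis g \<otimes>\<^bsub>R\<^esub> twisted_basis g = \<one>\<^bsub>R\<^esub>"
    and "twisted_basis h \<otimes>\<^bsub>R\<^esub> twisted_basis h = \<one>\<^bsub>R\<^esub>"
    and "inv\<^bsub>R\<^esub> (twisted_basis g) \<otimes>\<^bsub>R\<^esub> inv\<^bsub>R\<^esub> (twisted_basis h)
           \<otimes>\<^bsub>R\<^esub> twisted_basis g \<otimes>\<^bsub>R\<^esub> twisted_basis h = \<ominus>\<^bsub>R\<^esub> \<one>\<^bsub>R\<^esub>"
    and U_eq: "\<And>i. U i = congruence_units R i"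
  shows "(\<forall>i\<ge>1. subgroup (U i) (units_of R))
    \<and> card (rcosets\<^bsub>units_of R\<^esub> (U 1)) = 8
    \<and> (\<forall>i\<ge>1. U (i + 1) \<subseteq> U i \<and>
          card (rcosets\<^bsub>(units_of R)\<lparr>carrier := U i\<rparr>\<^esub> (U (i + 1))) = 8)
    \<and> (units_of R)\<lparr>carrier := U 1\<rparr> \<cong> free_group {..<3::nat} \<times>\<times> integer_mod_group 2
    \<and> (\<forall>i\<ge>2. (units_of R)\<lparr>carrier := U i\<rparr> \<cong> free_group {..<1 + 8 ^ (i - 1) :: nat})"
proof -
  interpret split_klein_ring G g h \<alpha>
    using assms by (intro split_klein_ringI) simp_all
  show ?thesis
    unfolding U_eq R_eq
    using subgroup_congruence_units card_rcosets_congruence_units_1 congruence_units_Suc_subset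
      card_rcosets_congruence_units_Suc congruence_units_1_free congruence_units_free
    by blast
qed

end
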